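(* Let $G$ be a nontrivial finite cyclic $p$-group (for some prime $p$). Then $G$ is a $\mathrm{BCI}$-group if and only if $G$ is isomorphic to one of the groups $\mathbb{Z}_2$, $\mathbb{Z}_4$, $\mathbb{Z}_3$, $\mathbb{Z}_9$, or $\mathbb{Z}_p$ where $p\geq 5$ is prime.
   Context: All groups are finite; graphs are finite, simple and undirected. For a group $G$ and a subset $S\subseteq G$, the bi-Cayley graph $\mathrm{BCay}(G,S)$ has vertex set $G\times\{1,2\}$ and edge set $\{\{(g,1),(sg,2)\}\mid g\in G,\ s\in S\}$. It is a $\mathrm{BCI}$-graph if whenever $\mathrm{BCay}(G,S)\cong\mathrm{BCay}(G,T)$ for some $T\subseteq G$, then $T=gS^{\alpha}$ for some $g\in G$ and $\alpha\in\mathrm{Aut}(G)$, where $S^\alpha$ is the image of $S$ under $\alpha$. A group $G$ is a $\mathrm{BCI}$-group if every bi-Cayley graph over $G$ is a $\mathrm{BCI}$-graph. $\mathbb{Z}_n$ denotes the cyclic group of order $n$. *)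

theory Defs
  imports "HOL-Algebra.Elementary_Groups" "HOL-Algebra.Bij"
    "HOL-Computational_Algebra.Primes" "Graph_Theory.Graph_Theory"
begin

text \<open>
  Undirected simple graphs are modelled, as in Graph\_Theory, by symmetric loop-free digraphs:
  an edge between u and v is represented by the two arcs (u, v) and (v, u).
\<close>

definition bicayley_edges :: "('a, 'b) monoid_scheme \<Rightarrow> 'a set \<Rightarrow> ('a \<times> nat) set set" where
  "bicayley_edges G S = {{(g, 1), (s \<otimes>\<^bsub>G\<^esub> g, 2)} | g s. g \<in> carrier G \<and> s \<in> S}"

definition BCay :: "('a, 'b) monoid_scheme \<Rightarrow> 'a set \<Rightarrow> ('a \<times> nat) pair_pre_digraph" where
  "BCay G S = \<lparr> pverts = carrier G \<times> {1, 2}, parcs = {(u, v). {u, v} \<in> bicayley_edges G S} \<rparr>"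

definition BCI_graph :: "('a, 'b) monoid_scheme \<Rightarrow> 'a set \<Rightarrow> bool" where
  "BCI_graph G S \<longleftrightarrow>
    (\<forall>T. T \<subseteq> carrier G \<and> digraph_iso (with_proj (BCay G S)) (with_proj (BCay G T)) \<longrightarrow>
      (\<exists>g \<in> carrier G. \<exists>\<alpha> \<in> auto G. T = g <#\<^bsub>G\<^esub> (\<alpha> ` S)))"

definition BCI_group :: "('a, 'b) monoid_scheme \<Rightarrow> bool" where
  "BCI_group G \<longleftrightarrow> (\<forall>S. S \<subseteq> carrier G \<longrightarrow> BCI_graph G S)"

lemma pair_graph_BCay:
  assumes "group G" "finite (carrier G)" "S \<subseteq> carrier G"
  shows "pair_graph (BCay G S)"
proof -
  interpret group G by fact
  have sub: "parcs (BCay G S) \<subseteq> pverts (BCay G S) \<times> pverts (BCay G S)"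
    using assms(3) by (auto simp: BCay_def bicayley_edges_def doubleton_eq_iff)
  have fin: "finite (pverts (BCay G S))"
    using assms(2) by (simp add: BCay_def)
  have sym: "sym (parcs (BCay G S))"
    by (auto simp: BCay_def sym_def insert_commute)
  show ?thesis
  proof
    show "finite (parcs (BCay G S))"
      using finite_subset[OF sub] fin by simp
    show "symmetric (with_proj (BCay G S))"
      using sym by (simp add: symmetric_def)
    show "fst e \<noteq> snd e" if "e \<in> parcs (BCay G S)" for e
      using that by (auto simp: BCay_def bicayley_edges_def doubleton_eq_iff)
  qed (use sub fin in auto)
qed

text \<open>
  On digraphs without parallel arcs, isomorphism in the sense of Graph\_Theory amounts to a
  bijection between the vertices that preserves and reflects adjacency.
\<close>

lemma digraph_iso_with_proj_iff:
  assumes "pair_wf_digraph A" "pair_wf_digraph B"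
  shows "digraph_iso (with_proj A) (with_proj B) \<longleftrightarrow>
    (\<exists>f. bij_betw f (pverts A) (pverts B) \<and>
      (\<forall>u \<in> pverts A. \<forall>v \<in> pverts A. (u, v) \<in> parcs A \<longleftrightarrow> (f u, f v) \<in> parcs B))"
    (is "?L \<longleftrightarrow> ?R")
proof
  interpret A: pair_wf_digraph A by fact
  interpret B: pair_wf_digraph B by fact
  {
    assume ?L
    then obtain h where h: "pre_digraph.digraph_isomorphism (with_proj A) h"
      and B: "with_proj B = app_iso h (with_proj A)"
      by (auto simp: digraph_iso_def)
    let ?f = "iso_verts h"
    have pv: "pverts B = ?f ` pverts A" and pa: "parcs B = iso_arcs h ` parcs A"
      and hd: "iso_head h = snd" and tl: "iso_tail h = fst"
      using arg_cong[OF B, of verts] arg_cong[OF B, of arcs]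
        arg_cong[OF B, of head] arg_cong[OF B, of tail] by simp_all
    have inj: "inj_on ?f (pverts A)"
      using h by (simp add: pre_digraph.digraph_isomorphism_def)
    have arc: "iso_arcs h (u, v) = (?f u, ?f v)" if "(u, v) \<in> parcs A" for u v
      using h that by (auto simp: pre_digraph.digraph_isomorphism_def hd tl prod_eq_iff)
    have "(u, v) \<in> parcs A \<longleftrightarrow> (?f u, ?f v) \<in> parcs B"
      if "u \<in> pverts A" "v \<in> pverts A" for u v
    proof
      assume "(u, v) \<in> parcs A"
      then show "(?f u, ?f v) \<in> parcs B"
        using arc pa by force
    next
      assume "(?f u, ?f v) \<in> parcs B"
      then obtain x y where xy: "(x, y) \<in> parcs A" "(?f u, ?f v) = (?f x, ?f y)"
        using arc pa by force
      then show "(u, v) \<in> parcs A"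
        using inj that A.in_arcsD1[OF xy(1)] A.in_arcsD2[OF xy(1)] by (auto dest: inj_onD)
    qed
    then show ?R
      using pv inj by (auto simp: bij_betw_def)
  }
  {
    assume ?R
    then obtain f where f: "bij_betw f (pverts A) (pverts B)"
      and adj: "\<And>u v. \<lbrakk>u \<in> pverts A; v \<in> pverts A\<rbrakk> \<Longrightarrow>
        (u, v) \<in> parcs A \<longleftrightarrow> (f u, f v) \<in> parcs B"
      by blast
    define h where "h = \<lparr> iso_verts = f, iso_arcs = map_prod f f,
      iso_head = (snd :: _ \<times> 'b \<Rightarrow> _), iso_tail = (fst :: _ \<times> 'b \<Rightarrow> _) \<rparr>"
    have inj: "inj_on f (pverts A)" and img: "f ` pverts A = pverts B"
      using f by (auto simp: bij_betw_def)
    have sub: "parcs A \<subseteq> pverts A \<times> pverts A"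
      using A.in_arcsD1 A.in_arcsD2 by auto
    have "inj_on (map_prod f f) (parcs A)"
      by (rule inj_on_subset[OF map_prod_inj_on[OF inj inj] sub])
    moreover have "wf_digraph (with_proj A)" by unfold_locales
    ultimately have "pre_digraph.digraph_isomorphism (with_proj A) h"
      using inj by (simp add: pre_digraph.digraph_isomorphism_def h_def)
    moreover have "parcs B = map_prod f f ` parcs A"
    proof (intro equalityI subsetI)
      fix e assume e: "e \<in> parcs B"
      then obtain x y where "x \<in> pverts A" "y \<in> pverts A" "e = (f x, f y)"
        using B.in_arcsD1 B.in_arcsD2 img by (cases e) (metis imageE)
      then show "e \<in> map_prod f f ` parcs A"
        using adj e by force
    next
      fix e assume "e \<in> map_prod f f ` parcs A"
      then show "e \<in> parcs B"
        using adj sub by auto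
    qed
    then have "with_proj B = app_iso h (with_proj A)"
      by (simp add: with_proj_def app_iso_def h_def img)
    ultimately show ?L
      by (auto simp: digraph_iso_def)
  }
qed

end

theory Submission
  imports Defs "HOL-Algebra.Multiplicative_Group" "HOL-Combinatorics.Permutations"
    "HOL-Number_Theory.Cong"
begin

text \<open>
  Over the integers mod n, being a BCI-group means that isomorphic graphs have connection sets
  related by an affine map.

  For n prime this follows from Babai's conjugacy argument, applied to the permutations of the
  residues that permute the translates of S: they form a group whose order divides n!, hence is
  not divisible by the square of n.

  For n = 4 and n = 9, fix a vertex u and c > 0. The number of pairs (v, w) such that any two of
  u, v, w have exactly c common neighbours is preserved by isomorphisms. As c > 0, the three
  vertices lie in the same part, so this number is determined by the overlaps of S with its
  translates. A computation shows that it separates the affine classes of subsets.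

  For the other prime powers, let S be the union of a full coset 1 + P of a subgroup P and of a
  subset of P. Multiplying by m inside every coset of P turns S into another set T with an
  isomorphic graph, while an affine map from S to T has to fix 1 + P, and so its multiplier is 1
  modulo the index of P. For powers of 2 the subset of P is replaced by {0, 2} and P has order 2.
\<close>

section \<open>Bi-Cayley graphs over cyclic groups\<close>

text \<open>An isomorphism may exchange the two parts and may act on them by different permutations;
  this shapes both positive arguments. For n prime, two elements of S make the graph connected, so
  at most an exchange of the parts remains; it is absorbed by replacing T with -T. For 4 and 9
  connectivity can fail, as for {0, 3} mod 9, hence a count that is the same at every vertex of
  either part. Overlaps alone are too coarse: {0, 1} and {0, 3} mod 9 both have exactly two shifts
  of overlap 1, and only the triangle counts 0 and 2 tell them apart.

  In the counterexamples the full coset 1 + P pins down the multiplier but does not see how the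
  cosets are permuted inside. A multiplier that is 1 mod p acts trivially on a group P of order p,
  so {0, 1} against {0, 2} works for p >= 5. For p = 3, subsets of Z_3 of equal size are translates
  of each other, so P needs order 9 and 27 is the first order reached. Modulo 8 multiplication
  inside the cosets yields nothing, since subsets of Z_4 are translates of their negatives; hence
  the separate set for p = 2.\<close>

definition bc_adj :: "('a, 'b) monoid_scheme \<Rightarrow> 'a set \<Rightarrow> 'a \<times> nat \<Rightarrow> 'a \<times> nat \<Rightarrow> bool" where
  "bc_adj G S u v \<longleftrightarrow>
    snd u = 1 \<and> snd v = 2 \<and> (\<exists>s\<in>S. fst v = s \<otimes>\<^bsub>G\<^esub> fst u) \<or>
    snd u = 2 \<and> snd v = 1 \<and> (\<exists>s\<in>S. fst u = s \<otimes>\<^bsub>G\<^esub> fst v)"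

definition bc_iso :: "('a, 'b) monoid_scheme \<Rightarrow> 'a set \<Rightarrow> 'a set \<Rightarrow> bool" where
  "bc_iso G S T \<longleftrightarrow> (\<exists>f. bij_betw f (carrier G \<times> {1, 2}) (carrier G \<times> {1, 2}) \<and>
    (\<forall>u\<in>carrier G \<times> {1, 2}. \<forall>v\<in>carrier G \<times> {1, 2}. bc_adj G S u v \<longleftrightarrow> bc_adj G T (f u) (f v)))"

lemma parcs_BCay_iff:
  assumes "u \<in> carrier G \<times> {1, 2}" "v \<in> carrier G \<times> {1, 2}"
  shows "(u, v) \<in> parcs (BCay G S) \<longleftrightarrow> bc_adj G S u v"
  using assms
  by (cases u; cases v) (auto simp: BCay_def bicayley_edges_def bc_adj_def doubleton_eq_iff)

lemma digraph_iso_BCay_iff: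
  assumes "group G" "finite (carrier G)" "S \<subseteq> carrier G" "T \<subseteq> carrier G"
  shows "digraph_iso (with_proj (BCay G S)) (with_proj (BCay G T)) \<longleftrightarrow> bc_iso G S T"
proof -
  interpret S: pair_graph "BCay G S" by (rule pair_graph_BCay) fact+
  interpret T: pair_graph "BCay G T" by (rule pair_graph_BCay) fact+
  have V: "pverts (BCay G S) = carrier G \<times> {1, 2}" for S
    by (simp add: BCay_def)
  have "(\<exists>f. bij_betw f (carrier G \<times> {1, 2}) (carrier G \<times> {1, 2}) \<and>
      (\<forall>u\<in>carrier G \<times> {1, 2}. \<forall>v\<in>carrier G \<times> {1, 2}.
        (u, v) \<in> parcs (BCay G S) \<longleftrightarrow> (f u, f v) \<in> parcs (BCay G T))) \<longleftrightarrow> bc_iso G S T"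
    unfolding bc_iso_def
    by (intro ex_cong1 conj_cong ball_cong refl) (simp add: parcs_BCay_iff bij_betw_apply)
  then show ?thesis
    by (subst digraph_iso_with_proj_iff) (use S.pair_wf_digraph_axioms T.pair_wf_digraph_axioms V in auto)
qed

lemma BCI_group_iff:
  assumes "group G" "finite (carrier G)"
  shows "BCI_group G \<longleftrightarrow> (\<forall>S T. S \<subseteq> carrier G \<longrightarrow> T \<subseteq> carrier G \<longrightarrow> bc_iso G S T \<longrightarrow>
    (\<exists>g\<in>carrier G. \<exists>\<alpha>\<in>auto G. T = g <#\<^bsub>G\<^esub> (\<alpha> ` S)))"
  using digraph_iso_BCay_iff[OF assms] unfolding BCI_group_def BCI_graph_def by blast

section \<open>Invariance under isomorphisms of groups\<close>

lemma bc_iso_image: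
  assumes G: "group G" and \<phi>: "\<phi> \<in> iso G H" and sub: "S \<subseteq> carrier G" "T \<subseteq> carrier G"
    and iso: "bc_iso G S T"
  shows "bc_iso H (\<phi> ` S) (\<phi> ` T)"
proof -
  interpret group G by fact
  from iso obtain f where f: "bij_betw f (carrier G \<times> {1, 2}) (carrier G \<times> {1, 2})"
    and adj: "\<And>u v. u \<in> carrier G \<times> {1, 2} \<Longrightarrow> v \<in> carrier G \<times> {1, 2} \<Longrightarrow>
      bc_adj G S u v \<longleftrightarrow> bc_adj G T (f u) (f v)"
    unfolding bc_iso_def by blast
  have bij: "bij_betw \<phi> (carrier G) (carrier H)" and hom: "\<phi> \<in> hom G H"
    using \<phi> by (auto simp: iso_def)
  define \<Phi> where "\<Phi> = map_prod \<phi> (id :: nat \<Rightarrow> nat)"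
  have \<Phi>: "bij_betw \<Phi> (carrier G \<times> {1, 2}) (carrier H \<times> {1, 2})"
    unfolding \<Phi>_def by (intro bij_betw_map_prod bij) (simp add: bij_betw_def)
  have adj_\<Phi>: "bc_adj H (\<phi> ` X) (\<Phi> u) (\<Phi> v) \<longleftrightarrow> bc_adj G X u v"
    if "X \<subseteq> carrier G" "u \<in> carrier G \<times> {1, 2}" "v \<in> carrier G \<times> {1, 2}" for X u v
  proof -
    have "(\<exists>s\<in>\<phi> ` X. \<phi> y = s \<otimes>\<^bsub>H\<^esub> \<phi> x) \<longleftrightarrow> (\<exists>s\<in>X. y = s \<otimes>\<^bsub>G\<^esub> x)"
      if "x \<in> carrier G" "y \<in> carrier G" for x y
    proof -
      have "\<phi> y = \<phi> s \<otimes>\<^bsub>H\<^esub> \<phi> x \<longleftrightarrow> y = s \<otimes>\<^bsub>G\<^esub> x" if "s \<in> X" for s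
      proof -
        have "s \<in> carrier G" using that \<open>X \<subseteq> carrier G\<close> by blast
        then show ?thesis
          using \<open>x \<in> carrier G\<close> \<open>y \<in> carrier G\<close> bij hom
          by (metis bij_betw_inv_into_left hom_mult m_closed)
      qed
      then show ?thesis by blast
    qed
    note * = this
    obtain x i y j where uv: "u = (x, i)" "v = (y, j)"
      by (cases u; cases v)
    then have "x \<in> carrier G" "y \<in> carrier G"
      using that by simp_all
    from *[OF this] *[OF this(2,1)] show ?thesis
      by (simp only: bc_adj_def \<Phi>_def uv fst_conv snd_conv map_prod_simp id_apply)
  qed
  define g where "g = \<Phi> \<circ> f \<circ> inv_into (carrier G \<times> {1, 2}) \<Phi>"
  have "bij_betw g (carrier H \<times> {1, 2}) (carrier H \<times> {1, 2})"
    unfolding g_def by (rule bij_betw_trans[OF bij_betw_inv_into[OF \<Phi>]], rule bij_betw_trans[OF f \<Phi>])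
  moreover have "bc_adj H (\<phi> ` S) u v \<longleftrightarrow> bc_adj H (\<phi> ` T) (g u) (g v)"
    if uv: "u \<in> carrier H \<times> {1, 2}" "v \<in> carrier H \<times> {1, 2}" for u v
  proof -
    obtain u' v' where u': "u' \<in> carrier G \<times> {1, 2}" "u = \<Phi> u'"
      and v': "v' \<in> carrier G \<times> {1, 2}" "v = \<Phi> v'"
      using uv unfolding bij_betw_imp_surj_on[OF \<Phi>, symmetric] by blast
    have "g u = \<Phi> (f u')" "g v = \<Phi> (f v')"
      using u' v' \<Phi> by (simp_all add: g_def bij_betw_inv_into_left)
    then show ?thesis
      using u' v' adj_\<Phi> sub adj f by (simp add: bij_betw_apply)
  qed
  ultimately show ?thesis
    unfolding bc_iso_def by blast
qed

lemma BCI_group_iso_imp: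
  assumes G: "group G" "finite (carrier G)" and H: "group H" and "G \<cong> H" and BCI: "BCI_group G"
  shows "BCI_group H"
proof -
  interpret G: group G by fact
  interpret H: group H by fact
  from \<open>G \<cong> H\<close> obtain \<phi> where \<phi>: "\<phi> \<in> iso G H"
    by (auto simp: is_iso_def)
  define \<psi> where "\<psi> = inv_into (carrier G) \<phi>"
  have \<psi>: "\<psi> \<in> iso H G"
    unfolding \<psi>_def by (rule G.iso_set_sym[OF \<phi>])
  have bij\<phi>: "bij_betw \<phi> (carrier G) (carrier H)" and bij\<psi>: "bij_betw \<psi> (carrier H) (carrier G)"
    and hom: "\<phi> \<in> hom G H" "\<psi> \<in> hom H G"
    using \<phi> \<psi> by (auto simp: iso_def)
  have fin: "finite (carrier H)"
    using G(2) bij\<phi> bij_betw_finite by blast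
  have \<phi>\<psi>: "\<phi> ` \<psi> ` X = X" if "X \<subseteq> carrier H" for X
    using that bij\<phi> unfolding \<psi>_def
    by (simp add: bij_betw_def image_inv_into_cancel)
  have "\<exists>g\<in>carrier H. \<exists>\<alpha>\<in>auto H. T = g <#\<^bsub>H\<^esub> (\<alpha> ` S)"
    if sub: "S \<subseteq> carrier H" "T \<subseteq> carrier H" and iso: "bc_iso H S T" for S T
  proof -
    have sub': "\<psi> ` S \<subseteq> carrier G" "\<psi> ` T \<subseteq> carrier G"
      using sub bij_betw_imp_surj_on[OF bij\<psi>] by blast+
    have "bc_iso G (\<psi> ` S) (\<psi> ` T)"
      by (rule bc_iso_image[OF H \<psi> sub iso])
    with BCI sub' have "\<exists>g\<in>carrier G. \<exists>\<alpha>\<in>auto G. \<psi> ` T = g <#\<^bsub>G\<^esub> (\<alpha> ` \<psi> ` S)"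
      unfolding BCI_group_iff[OF G] by simp
    then obtain g \<alpha> where g: "g \<in> carrier G" and \<alpha>: "\<alpha> \<in> auto G"
      and T: "\<psi> ` T = g <#\<^bsub>G\<^esub> (\<alpha> ` \<psi> ` S)"
      by (elim bexE)
    have \<alpha>': "\<alpha> \<in> hom G G" "bij_betw \<alpha> (carrier G) (carrier G)"
      using \<alpha> by (auto simp: auto_def Bij_def)
    \<comment> \<open>Members of \<open>auto H\<close> are extensional, so the conjugate of \<alpha>
      has to be restricted to the carrier.\<close>
    define \<beta> where "\<beta> = restrict (\<phi> \<circ> (\<alpha> \<circ> \<psi>)) (carrier H)"
    have "\<phi> \<circ> (\<alpha> \<circ> \<psi>) \<in> hom H H"
      using hom_compose[OF hom_compose[OF hom(2) \<alpha>'(1)] hom(1)] by (simp add: comp_assoc)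
    then have "\<beta> \<in> hom H H"
      unfolding \<beta>_def by (auto simp: hom_def)
    moreover have "bij_betw (\<phi> \<circ> (\<alpha> \<circ> \<psi>)) (carrier H) (carrier H)"
      by (rule bij_betw_trans[OF bij_betw_trans[OF bij\<psi> \<alpha>'(2)] bij\<phi>])
    then have "bij_betw \<beta> (carrier H) (carrier H)"
      by (rule iffD1[OF bij_betw_cong, rotated]) (simp add: \<beta>_def)
    ultimately have "\<beta> \<in> auto H"
      unfolding auto_def Bij_def by (simp add: \<beta>_def)
    moreover have "T = \<phi> g <#\<^bsub>H\<^esub> (\<beta> ` S)"
    proof -
      have "T = \<phi> ` (g <#\<^bsub>G\<^esub> (\<alpha> ` \<psi> ` S))"
        using \<phi>\<psi>[OF sub(2)] T by simp
      also have "\<dots> = (\<lambda>s. \<phi> (g \<otimes>\<^bsub>G\<^esub> \<alpha> (\<psi> s))) ` S"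
        by (auto simp: l_coset_def)
      also have "\<dots> = (\<lambda>s. \<phi> g \<otimes>\<^bsub>H\<^esub> \<beta> s) ` S"
      proof (rule image_cong[OF refl])
        fix s assume "s \<in> S"
        then have "s \<in> carrier H" "\<alpha> (\<psi> s) \<in> carrier G"
          using sub(1) bij_betw_apply[OF bij\<psi>] bij_betw_apply[OF \<alpha>'(2)] by blast+
        then show "\<phi> (g \<otimes>\<^bsub>G\<^esub> \<alpha> (\<psi> s)) = \<phi> g \<otimes>\<^bsub>H\<^esub> \<beta> s"
          using g hom by (simp add: hom_mult \<beta>_def)
      qed
      also have "\<dots> = \<phi> g <#\<^bsub>H\<^esub> (\<beta> ` S)"
        by (auto simp: l_coset_def)
      finally show ?thesis .
    qed
    ultimately show ?thesis
      using bij_betw_apply[OF bij\<phi> g] by blast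
  qed
  then show ?thesis
    unfolding BCI_group_iff[OF H fin] by simp
qed

section \<open>Affine maps and bi-Cayley graphs over the residues modulo n\<close>

abbreviation Zn :: "nat \<Rightarrow> int set" where
  "Zn n \<equiv> {0..<int n}"

lemma Zn_eq_iff_dvd: "x \<in> Zn n \<Longrightarrow> y \<in> Zn n \<Longrightarrow> x = y \<longleftrightarrow> int n dvd x - y"
  by (metis atLeastLessThan_iff mod_eq_dvd_iff mod_pos_pos_trivial)

lemma mod_affine: "(c * (t mod m) + d) mod m = (c * t + d) mod (m :: int)"
  by (metis mod_add_left_eq mod_mult_right_eq)

lemma coprime_dvd_cancel:
  assumes "coprime (a :: int) n" "n dvd a * x" shows "n dvd x"
  using assms by (metis coprime_commute coprime_dvd_mult_right_iff)

lemma affine_inj_on: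
  assumes "coprime a (int n)" shows "inj_on (\<lambda>x. (a * x + b) mod int n) (Zn n)"
proof (rule inj_onI)
  fix x y assume xy: "x \<in> Zn n" "y \<in> Zn n" "(a * x + b) mod int n = (a * y + b) mod int n"
  then have "int n dvd a * (x - y)"
    by (simp add: mod_eq_dvd_iff algebra_simps)
  then have "int n dvd x - y"
    by (rule coprime_dvd_cancel[OF assms])
  then show "x = y"
    by (simp only: Zn_eq_iff_dvd[OF xy(1,2)])
qed

lemma affine_surj:
  assumes n: "n > 0" and a: "coprime a (int n)" and y: "y \<in> Zn n"
  obtains x where "x \<in> Zn n" "(a * x + b) mod int n = y"
proof -
  have "(\<lambda>x. (a * x + b) mod int n) ` Zn n \<subseteq> Zn n"
    using n by auto
  then have "(\<lambda>x. (a * x + b) mod int n) ` Zn n = Zn n"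
    by (rule endo_inj_surj[OF finite_atLeastLessThan_int _ affine_inj_on[OF a]])
  then have "y \<in> (\<lambda>x. (a * x + b) mod int n) ` Zn n"
    using y by (simp only:)
  then show thesis
    using that by blast
qed

text \<open>Multiplier and shift are arbitrary integers, not residues, so composing two maps needs
  no reduction of the coefficients.\<close>

definition affine_equiv :: "nat \<Rightarrow> int set \<Rightarrow> int set \<Rightarrow> bool" where
  "affine_equiv n S T \<longleftrightarrow> (\<exists>a b. coprime a (int n) \<and> T = (\<lambda>x. (a * x + b) mod int n) ` S)"

text \<open>Bi-Cayley graphs of cyclic groups are known as Haar graphs. Writing the edge condition
  as a difference removes the existential quantifier over S.\<close>

definition haar_adj :: "nat \<Rightarrow> int set \<Rightarrow> int \<times> nat \<Rightarrow> int \<times> nat \<Rightarrow> bool" where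
  "haar_adj n S u v \<longleftrightarrow>
    snd u = 1 \<and> snd v = 2 \<and> (fst v - fst u) mod int n \<in> S \<or>
    snd u = 2 \<and> snd v = 1 \<and> (fst u - fst v) mod int n \<in> S"

definition haar_iso :: "nat \<Rightarrow> int set \<Rightarrow> int set \<Rightarrow> bool" where
  "haar_iso n S T \<longleftrightarrow> (\<exists>f. bij_betw f (Zn n \<times> {1, 2}) (Zn n \<times> {1, 2}) \<and>
    (\<forall>u\<in>Zn n \<times> {1, 2}. \<forall>v\<in>Zn n \<times> {1, 2}. haar_adj n S u v \<longleftrightarrow> haar_adj n T (f u) (f v)))"

lemma bc_adj_integer_mod_group:
  assumes "n > 0" "S \<subseteq> Zn n" "u \<in> Zn n \<times> {1, 2}" "v \<in> Zn n \<times> {1, 2}"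
  shows "bc_adj (integer_mod_group n) S u v \<longleftrightarrow> haar_adj n S u v"
proof -
  have "(\<exists>s\<in>S. y = (s + x) mod int n) \<longleftrightarrow> (y - x) mod int n \<in> S"
    if "x \<in> Zn n" "y \<in> Zn n" for x y
  proof
    assume "\<exists>s\<in>S. y = (s + x) mod int n"
    then obtain s where s: "s \<in> S" "y = (s + x) mod int n" by blast
    then have "(y - x) mod int n = s"
      using assms(2) by (auto simp: mod_diff_left_eq)
    then show "(y - x) mod int n \<in> S" using s by simp
  next
    assume "(y - x) mod int n \<in> S"
    moreover have "y = ((y - x) mod int n + x) mod int n"
      using that by (simp add: mod_add_left_eq)
    ultimately show "\<exists>s\<in>S. y = (s + x) mod int n" by blast
  qed
  note * = this
  obtain x i y j where uv: "u = (x, i)" "v = (y, j)"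
    by (cases u; cases v)
  then have "x \<in> Zn n" "y \<in> Zn n"
    using assms(3,4) by simp_all
  from *[OF this] *[OF this(2,1)] show ?thesis
    by (simp only: bc_adj_def haar_adj_def uv fst_conv snd_conv mult_integer_mod_group)
qed

lemma auto_integer_mod_group_iff:
  assumes "n > 0"
  shows "\<alpha> \<in> auto (integer_mod_group n) \<longleftrightarrow>
    (\<exists>a. coprime a (int n) \<and> \<alpha> = restrict (\<lambda>x. (a * x) mod int n) (Zn n))"
proof -
  let ?G = "integer_mod_group n"
  have car: "carrier ?G = Zn n"
    using assms by (simp add: carrier_integer_mod_group)
  have sub: "(\<lambda>x. (a * x) mod int n) ` Zn n \<subseteq> Zn n" for a
    using assms by auto
  have "\<alpha> \<in> auto ?G" if a: "coprime a (int n)" and \<alpha>: "\<alpha> = restrict (\<lambda>x. (a * x) mod int n) (Zn n)" for a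
  proof -
    have "bij_betw (\<lambda>x. (a * x) mod int n) (Zn n) (Zn n)"
      unfolding bij_betw_def using affine_inj_on[OF a, of 0] sub[of a]
      by (simp add: endo_inj_surj)
    then have "bij_betw \<alpha> (Zn n) (Zn n)"
      by (rule iffD1[OF bij_betw_cong, rotated]) (simp add: \<alpha>)
    moreover have "\<alpha> \<in> hom ?G ?G"
      using assms by (auto simp: hom_def car \<alpha> mod_simps ring_distribs)
    ultimately show ?thesis
      by (simp add: auto_def Bij_def car \<alpha>)
  qed
  moreover have "\<exists>a. coprime a (int n) \<and> \<alpha> = restrict (\<lambda>x. (a * x) mod int n) (Zn n)"
    if \<alpha>: "\<alpha> \<in> auto ?G"
  proof -
    have hom: "\<alpha> \<in> hom ?G ?G" and ext: "\<alpha> \<in> extensional (Zn n)" and bij: "bij_betw \<alpha> (Zn n) (Zn n)"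
      using \<alpha> by (auto simp: auto_def Bij_def car)
    \<comment> \<open>The generator is \<open>1 mod int n\<close> and not 1, because for n = 1 the
      only residue is 0.\<close>
    define a where "a = \<alpha> (1 mod int n)"
    have "1 mod int n \<in> carrier ?G" "group_hom ?G ?G \<alpha>"
      using assms hom by (simp_all add: car group_hom_def group_hom_axioms_def)
    have *: "\<alpha> x = (a * x) mod int n" if "x \<in> Zn n" for x
    proof -
      have "x = (1 mod int n) [^]\<^bsub>?G\<^esub> nat x"
        using that assms \<open>1 mod int n \<in> carrier ?G\<close> by (simp add: mod_simps)
      then have "\<alpha> x = a [^]\<^bsub>?G\<^esub> nat x"
        using group_hom.hom_nat_pow[OF \<open>group_hom ?G ?G \<alpha>\<close> \<open>1 mod int n \<in> carrier ?G\<close>]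
        unfolding a_def by metis
      moreover have "a \<in> carrier ?G"
        using bij_betw_apply[OF bij, of "1 mod int n"] assms unfolding a_def by (simp add: car)
      ultimately show ?thesis
        using that by (simp add: mult.commute)
    qed
    \<comment> \<open>Surjectivity yields an x with a * x = 1 modulo n, so a is a unit.\<close>
    have "1 mod int n \<in> \<alpha> ` Zn n"
      using bij assms by (simp add: bij_betw_def)
    then obtain x where "(a * x) mod int n = 1 mod int n"
      using * by auto
    then have "coprime a (int n)"
      by (metis coprime_1_left coprime_mod_left_iff coprime_mult_left_iff assms of_nat_0_less_iff less_irrefl)
    moreover have "\<alpha> = restrict (\<lambda>x. (a * x) mod int n) (Zn n)"
      using ext * by (auto simp: fun_eq_iff extensional_def)
    ultimately show ?thesis by blast
  qed
  ultimately show ?thesis by blast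
qed

text \<open>Automorphisms are multiplications by units, so the sets g + \<alpha>(S) are exactly the
  images of S under affine maps.\<close>

lemma BCI_integer_mod_group_iff:
  assumes n: "n > 0"
  shows "BCI_group (integer_mod_group n) \<longleftrightarrow>
    (\<forall>S T. S \<subseteq> Zn n \<longrightarrow> T \<subseteq> Zn n \<longrightarrow> haar_iso n S T \<longrightarrow> affine_equiv n S T)"
proof -
  let ?G = "integer_mod_group n"
  have car: "carrier ?G = Zn n"
    using n by (simp add: carrier_integer_mod_group)
  have iso: "bc_iso ?G S T \<longleftrightarrow> haar_iso n S T" if "S \<subseteq> Zn n" "T \<subseteq> Zn n" for S T
    unfolding bc_iso_def haar_iso_def car
    by (intro ex_cong1 conj_cong ball_cong refl)
      (simp add: bc_adj_integer_mod_group n that bij_betw_apply)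
  have aff: "(\<exists>g\<in>Zn n. \<exists>\<alpha>\<in>auto ?G. T = g <#\<^bsub>?G\<^esub> (\<alpha> ` S)) \<longleftrightarrow> affine_equiv n S T"
    if "S \<subseteq> Zn n" for S T
  proof -
    have img: "g <#\<^bsub>?G\<^esub> (restrict (\<lambda>x. (a * x) mod int n) (Zn n) ` S) = (\<lambda>x. (a * x + g) mod int n) ` S"
      for g a
    proof -
      have "g <#\<^bsub>?G\<^esub> (restrict (\<lambda>x. (a * x) mod int n) (Zn n) ` S) =
          (\<lambda>x. (g + restrict (\<lambda>x. (a * x) mod int n) (Zn n) x) mod int n) ` S"
        unfolding l_coset_def by (simp only: mult_integer_mod_group) blast
      also have "\<dots> = (\<lambda>x. (a * x + g) mod int n) ` S"
      proof (rule image_cong[OF refl])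
        fix x assume "x \<in> S"
        then have "x \<in> Zn n" using that by blast
        then show "(g + restrict (\<lambda>x. (a * x) mod int n) (Zn n) x) mod int n = (a * x + g) mod int n"
          by (simp add: mod_simps add.commute)
      qed
      finally show ?thesis .
    qed
    show ?thesis
    proof
      assume "affine_equiv n S T"
      then obtain a b where "coprime a (int n)" "T = (\<lambda>x. (a * x + b) mod int n) ` S"
        by (auto simp: affine_equiv_def)
      then have "coprime a (int n)" "T = (\<lambda>x. (a * x + b mod int n) mod int n) ` S"
        by (simp_all add: mod_simps)
      then have "T = (b mod int n) <#\<^bsub>?G\<^esub> (restrict (\<lambda>x. (a * x) mod int n) (Zn n) ` S)"
        by (simp only: img)
      moreover have "b mod int n \<in> Zn n" using n by simp
      ultimately show "\<exists>g\<in>Zn n. \<exists>\<alpha>\<in>auto ?G. T = g <#\<^bsub>?G\<^esub> (\<alpha> ` S)"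
        using \<open>coprime a (int n)\<close> auto_integer_mod_group_iff[OF n] by blast
    next
      assume "\<exists>g\<in>Zn n. \<exists>\<alpha>\<in>auto ?G. T = g <#\<^bsub>?G\<^esub> (\<alpha> ` S)"
      then obtain g \<alpha> where "\<alpha> \<in> auto ?G" "T = g <#\<^bsub>?G\<^esub> (\<alpha> ` S)"
        by blast
      then obtain a where "coprime a (int n)"
        "T = g <#\<^bsub>?G\<^esub> (restrict (\<lambda>x. (a * x) mod int n) (Zn n) ` S)"
        unfolding auto_integer_mod_group_iff[OF n] by blast
      then show "affine_equiv n S T"
        unfolding img affine_equiv_def by blast
    qed
  qed
  have "finite (carrier ?G)"
    by (simp add: car)
  then show ?thesis
    by (simp add: BCI_group_iff car iso aff cong: imp_cong)
qed

section \<open>Prime order\<close>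

text \<open>Conjugation by a is a homomorphism. With m inverse to v modulo the order of k, a
  relation for some power of k becomes one for k itself.\<close>

lemma (in group) conj_int_pow:
  assumes "a \<in> carrier G" "h \<in> carrier G" "k \<in> carrier G"
    and "a \<otimes> k [^] (v::int) = h [^] (u::int) \<otimes> a"
  shows "a \<otimes> k [^] (v * int m) = h [^] (u * int m) \<otimes> a"
proof (induction m)
  case (Suc m)
  have Suc_eq: "v * int (Suc m) = v * int m + v" "u * int (Suc m) = u * int m + u"
    by (simp_all add: algebra_simps)
  have "a \<otimes> k [^] (v * int (Suc m)) = (a \<otimes> k [^] (v * int m)) \<otimes> k [^] v"
    using assms(1-3) by (simp add: Suc_eq int_pow_mult m_assoc del: of_nat_Suc)
  also have "\<dots> = h [^] (u * int m) \<otimes> (a \<otimes> k [^] v)"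
    using assms(1-3) by (simp add: Suc m_assoc)
  also have "\<dots> = h [^] (u * int (Suc m)) \<otimes> a"
    using assms(1-3) by (simp add: assms(4) Suc_eq int_pow_mult m_assoc del: of_nat_Suc)
  finally show ?case .
qed (use assms in simp)

text \<open>
  If no such conjugation existed, every double coset of the subgroups generated by h and k
  would have p^2 elements.
\<close>

lemma (in group) prime_order_conj:
  assumes fin: "finite (carrier G)" and p: "Factorial_Ring.prime p"
    and ndvd: "\<not> p\<^sup>2 dvd order G"
    and h: "h \<in> carrier G" "ord h = p" and k: "k \<in> carrier G" "ord k = p"
  obtains a w where "a \<in> carrier G" "a \<otimes> k = h [^] (w::nat) \<otimes> a"
proof (rule ccontr)
  assume *: "\<not> thesis"
  note conj = that
  have no: "a \<otimes> k \<noteq> h [^] (w::nat) \<otimes> a" if "a \<in> carrier G" for a w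
    using conj[OF that] * by blast
  have hpow: "h [^] i = h [^] j \<longleftrightarrow> int p dvd (i - j)"
    and kpow: "k [^] i = k [^] j \<longleftrightarrow> int p dvd (i - j)" for i j :: int
    using int_pow_eq[OF h(1)] int_pow_eq[OF k(1)] h k by (simp_all add: dvd_diff_commute)
  define r where "r = {(a, b). a \<in> carrier G \<and> b \<in> carrier G \<and>
    (\<exists>(i::int) (j::int). b = h [^] i \<otimes> a \<otimes> k [^] j)}"
  have r: "equiv (carrier G) r"
  proof (rule equivI)
    show "r \<subseteq> carrier G \<times> carrier G" by (auto simp: r_def)
    show "refl_on (carrier G) r"
    proof (rule refl_onI)
      fix a assume a: "a \<in> carrier G"
      have "\<exists>(i::int) (j::int). a = h [^] i \<otimes> a \<otimes> k [^] j"
        by (rule exI[of _ 0], rule exI[of _ 0]) (use a in simp)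
      then show "(a, a) \<in> r"
        unfolding r_def mem_Collect_eq case_prod_conv using a by blast
    qed
    show "sym r"
    proof (rule symI)
      fix a b assume "(a, b) \<in> r"
      then obtain i j :: int where ab: "a \<in> carrier G" "b \<in> carrier G"
        and b: "b = h [^] i \<otimes> a \<otimes> k [^] j"
        unfolding r_def by auto
      have "h [^] (-i) \<otimes> (h [^] i \<otimes> a \<otimes> k [^] j) \<otimes> k [^] (-j) =
          (h [^] (-i) \<otimes> h [^] i) \<otimes> a \<otimes> (k [^] j \<otimes> k [^] (-j))"
        using ab h k by (simp add: m_assoc)
      then have "a = h [^] (-i) \<otimes> b \<otimes> k [^] (-j)"
        using ab h k unfolding b by (simp add: int_pow_mult[symmetric])
      then show "(b, a) \<in> r"
        using ab unfolding r_def by auto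
    qed
    show "trans r"
    proof (rule transI)
      fix a b c assume "(a, b) \<in> r" "(b, c) \<in> r"
      then obtain i j i' j' :: int where abc: "a \<in> carrier G" "c \<in> carrier G"
        and "b = h [^] i \<otimes> a \<otimes> k [^] j" "c = h [^] i' \<otimes> b \<otimes> k [^] j'"
        unfolding r_def by auto
      then have "c = h [^] (i' + i) \<otimes> a \<otimes> k [^] (j + j')"
        using h k by (simp add: m_assoc int_pow_mult)
      then show "(a, c) \<in> r"
        using abc unfolding r_def by auto
    qed
  qed
  have "card (r `` {a}) = p\<^sup>2" if a: "a \<in> carrier G" for a
  proof -
    let ?F = "\<lambda>(i::int, j::int). h [^] i \<otimes> a \<otimes> k [^] j"
    let ?I = "{0..<int p} \<times> {0..<int p}"
    have "p > 0" using p by (simp add: prime_gt_0_nat)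
    have "r `` {a} = ?F ` ?I"
    proof (intro equalityI subsetI)
      fix b assume "b \<in> r `` {a}"
      then obtain i j :: int where b: "b = h [^] i \<otimes> a \<otimes> k [^] j"
        by (auto simp: r_def)
      have "h [^] i = h [^] (i mod int p)" "k [^] j = k [^] (j mod int p)"
        by (simp_all add: hpow kpow)
      then have "b = ?F (i mod int p, j mod int p)"
        using b by simp
      then show "b \<in> ?F ` ?I"
        using \<open>p > 0\<close> by (intro image_eqI[of _ _ "(i mod int p, j mod int p)"]) auto
    qed (use a h k in \<open>auto simp: r_def\<close>)
    moreover have "inj_on ?F ?I"
    proof (rule inj_onI, clarify)
      fix i j i' j' assume ij: "i \<in> {0..<int p}" "j \<in> {0..<int p}" "i' \<in> {0..<int p}" "j' \<in> {0..<int p}"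
        and eq: "h [^] i \<otimes> a \<otimes> k [^] j = h [^] i' \<otimes> a \<otimes> k [^] j'"
      have "h [^] (-i') \<otimes> (h [^] i \<otimes> a \<otimes> k [^] j) \<otimes> k [^] (-j) =
        h [^] (-i') \<otimes> (h [^] i' \<otimes> a \<otimes> k [^] j') \<otimes> k [^] (-j)"
        using eq by simp
      moreover have "h [^] (-i') \<otimes> (h [^] i \<otimes> a \<otimes> k [^] j) \<otimes> k [^] (-j) =
        (h [^] (-i') \<otimes> h [^] i) \<otimes> a \<otimes> (k [^] j \<otimes> k [^] (-j))"
        "h [^] (-i') \<otimes> (h [^] i' \<otimes> a \<otimes> k [^] j') \<otimes> k [^] (-j) =
        (h [^] (-i') \<otimes> h [^] i') \<otimes> a \<otimes> (k [^] j' \<otimes> k [^] (-j))"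
        using a h k by (simp_all add: m_assoc)
      ultimately have *: "a \<otimes> k [^] (j' - j) = h [^] (i - i') \<otimes> a"
        using a h k by (simp add: int_pow_mult[symmetric])
      \<comment> \<open>Otherwise j' - j is invertible modulo p, and raising the relation to the
        inverse power m, taken as a natural number, shows that a conjugates k into the powers of h,
        which is excluded.\<close>
      have "int p dvd j' - j"
      proof (rule ccontr)
        assume "\<not> int p dvd j' - j"
        then have "coprime (j' - j) (int p)"
          using p by (metis coprime_commute prime_imp_coprime prime_nat_int_transfer)
        then obtain x where x: "[(j' - j) * x = 1] (mod int p)"
          using cong_solve_coprime_int by blast
        define m where "m = nat (x mod int p)"
        have "[(j' - j) * int m = 1] (mod int p)"
          using x \<open>p > 0\<close> unfolding m_def cong_def by (simp add: mod_mult_right_eq)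
        then have "k [^] ((j' - j) * int m) = k [^] (1::int)"
          by (simp add: kpow cong_iff_dvd_diff)
        then have "a \<otimes> k = h [^] ((i - i') * int m) \<otimes> a"
          using conj_int_pow[OF a h(1) k(1) *, of m] k(1) by (simp add: int_pow_1)
        also have "h [^] ((i - i') * int m) = h [^] int (nat ((i - i') * int m mod int p))"
          using \<open>p > 0\<close> by (simp add: hpow)
        finally show False
          using no[OF a] by (simp only: int_pow_int)
      qed
      then have "k [^] (j' - j) = k [^] (0::int)"
        by (simp only: kpow diff_zero)
      then have "h [^] (i - i') \<otimes> a = \<one> \<otimes> a"
        using * a by simp
      then have "h [^] (i - i') = h [^] (0::int)"
        using a h by simp
      then have "int p dvd i - i'"
        by (simp only: hpow diff_zero)
      have "x = y" if "int p dvd x - y" "x \<in> {0..<int p}" "y \<in> {0..<int p}" for x y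
        using that by (metis atLeastLessThan_iff mod_eq_dvd_iff mod_pos_pos_trivial)
      from this[OF \<open>int p dvd i - i'\<close>] this[OF \<open>int p dvd j' - j\<close>]
      show "i = i' \<and> j = j'"
        using ij by simp
    qed
    ultimately show ?thesis
      by (simp add: card_image power2_eq_square)
  qed
  then have "p\<^sup>2 dvd card (carrier G)"
    by (intro equiv_imp_dvd_card[OF fin r]) (auto elim!: quotientE)
  then show False
    using ndvd by (simp add: order_def)
qed

section \<open>Symmetric groups\<close>

definition perm_group :: "'a set \<Rightarrow> ('a \<Rightarrow> 'a) monoid" where
  "perm_group X = \<lparr>carrier = {f. f permutes X}, monoid.mult = (\<circ>), one = id\<rparr>"

lemma group_perm_group: "group (perm_group X)"
proof (rule groupI)
  show "\<exists>y\<in>carrier (perm_group X). y \<otimes>\<^bsub>perm_group X\<^esub> x = \<one>\<^bsub>perm_group X\<^esub>"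
    if "x \<in> carrier (perm_group X)" for x
    using that permutes_inv[of x X] permutes_inv_o(2)[of x X] by (auto simp: perm_group_def)
qed (auto simp: perm_group_def permutes_compose permutes_id comp_assoc)

lemma order_perm_group: "finite X \<Longrightarrow> order (perm_group X) = fact (card X)"
  by (simp add: order_def perm_group_def card_permutations)

lemma perm_group_pow:
  "f [^]\<^bsub>(perm_group X)\<lparr>carrier := A\<rparr>\<^esub> (m::nat) = f ^^ m"
  by (induction m) (simp_all add: perm_group_def nat_pow_def funpow_Suc_right del: funpow.simps(2))

text \<open>In p! = p (p - 1)! the second factor is prime to p. By Lagrange, p^2 then divides the
  order of no permutation group on p points.\<close>

lemma prime_square_not_dvd_fact:
  assumes "Factorial_Ring.prime (p::nat)"
  shows "\<not> p\<^sup>2 dvd fact p"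
proof
  assume "p\<^sup>2 dvd fact p"
  moreover have "(fact p :: nat) = p * fact (p - 1)"
    using assms by (simp add: fact_reduce prime_gt_0_nat)
  ultimately have "p dvd fact (p - 1)"
    using assms by (simp add: power2_eq_square prime_gt_0_nat)
  then have "p \<le> p - 1"
    using prime_dvd_fact_iff[OF assms] by blast
  then show False
    using prime_gt_0_nat[OF assms] by linarith
qed

section \<open>Affine equivalence and isomorphisms preserving the two parts\<close>

lemma affine_equiv_trans:
  assumes "affine_equiv n S T" "affine_equiv n T U"
  shows "affine_equiv n S U"
proof -
  from assms obtain a b c d where "coprime a (int n)" "T = (\<lambda>x. (a * x + b) mod int n) ` S"
    "coprime c (int n)" "U = (\<lambda>x. (c * x + d) mod int n) ` T"
    unfolding affine_equiv_def by blast
  then have "coprime (c * a) (int n)" "U = (\<lambda>x. (c * a * x + (c * b + d)) mod int n) ` S"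
    by (simp_all add: image_image mod_affine) (simp add: algebra_simps)
  then show ?thesis
    unfolding affine_equiv_def by blast
qed

lemma affine_equiv_sym:
  assumes "S \<subseteq> Zn n" "affine_equiv n S T"
  shows "affine_equiv n T S"
proof -
  from assms obtain a b where a: "coprime a (int n)" and T: "T = (\<lambda>x. (a * x + b) mod int n) ` S"
    unfolding affine_equiv_def by blast
  obtain c where c: "[a * c = 1] (mod int n)"
    using cong_solve_coprime_int[OF a] by blast
  then have "coprime c (int n)"
    by (metis cong_imp_coprime cong_sym coprime_1_left coprime_mult_left_iff)
  moreover have "S = (\<lambda>y. (c * y + - c * b) mod int n) ` T"
  proof -
    have "(c * ((a * x + b) mod int n) + - c * b) mod int n = x" if "x \<in> S" for x
    proof -
      have "(c * ((a * x + b) mod int n) + - c * b) mod int n = (c * (a * x + b) + - c * b) mod int n"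
        by (rule mod_affine)
      also have "\<dots> = ((a * c) * x) mod int n"
        by (simp add: algebra_simps)
      also have "\<dots> = x mod int n"
        using cong_mult[OF c cong_refl[of x]] by (simp add: cong_def)
      also have "\<dots> = x"
        using assms(1) that by (auto simp: subset_iff)
      finally show ?thesis .
    qed
    then show ?thesis
      unfolding T image_image by simp
  qed
  ultimately show ?thesis
    unfolding affine_equiv_def by blast
qed

text \<open>The residues are points, and the neighbourhoods y - S of the vertices (y, 2) are blocks.
  Only the action \<sigma> on points is recorded, while the action \<tau> on blocks is quantified
  away; so the automorphisms form a subgroup of the symmetric group on n points, whose order divides
  n!.\<close>

definition design_iso :: "nat \<Rightarrow> int set \<Rightarrow> int set \<Rightarrow> (int \<Rightarrow> int) \<Rightarrow> bool" where
  "design_iso n S T \<sigma> \<longleftrightarrow> \<sigma> permutes Zn n \<and> (\<exists>\<tau>. \<tau> permutes Zn n \<and>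
    (\<forall>x\<in>Zn n. \<forall>y\<in>Zn n. (y - x) mod int n \<in> S \<longleftrightarrow> (\<tau> y - \<sigma> x) mod int n \<in> T))"

lemma design_iso_id: "design_iso n S S id"
  unfolding design_iso_def by (auto intro!: exI[of _ id] permutes_id)

lemma design_iso_comp:
  assumes "design_iso n S T \<sigma>" "design_iso n T U \<sigma>'"
  shows "design_iso n S U (\<sigma>' \<circ> \<sigma>)"
proof -
  from assms obtain \<tau> \<tau>' where p: "\<sigma> permutes Zn n" "\<sigma>' permutes Zn n" "\<tau> permutes Zn n" "\<tau>' permutes Zn n"
    and "\<forall>x\<in>Zn n. \<forall>y\<in>Zn n. (y - x) mod int n \<in> S \<longleftrightarrow> (\<tau> y - \<sigma> x) mod int n \<in> T"
    and "\<forall>x\<in>Zn n. \<forall>y\<in>Zn n. (y - x) mod int n \<in> T \<longleftrightarrow> (\<tau>' y - \<sigma>' x) mod int n \<in> U"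
    unfolding design_iso_def by blast
  moreover have "\<sigma> x \<in> Zn n" "\<tau> x \<in> Zn n" if "x \<in> Zn n" for x
    using p that by (simp_all only: permutes_in_image)
  ultimately show ?thesis
    unfolding design_iso_def
    by (intro conjI permutes_compose exI[of _ "\<tau>' \<circ> \<tau>"]) (simp_all del: atLeastLessThan_iff)
qed

lemma design_iso_inv:
  assumes "design_iso n S T \<sigma>"
  shows "design_iso n T S (Hilbert_Choice.inv \<sigma>)"
proof -
  from assms obtain \<tau> where p: "\<sigma> permutes Zn n" "\<tau> permutes Zn n"
    and *: "\<forall>x\<in>Zn n. \<forall>y\<in>Zn n. (y - x) mod int n \<in> S \<longleftrightarrow> (\<tau> y - \<sigma> x) mod int n \<in> T"
    unfolding design_iso_def by blast
  have "(y - x) mod int n \<in> T \<longleftrightarrow> (Hilbert_Choice.inv \<tau> y - Hilbert_Choice.inv \<sigma> x) mod int n \<in> S"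
    if "x \<in> Zn n" "y \<in> Zn n" for x y
  proof -
    have "Hilbert_Choice.inv \<sigma> x \<in> Zn n" "Hilbert_Choice.inv \<tau> y \<in> Zn n"
      using p that by (simp_all only: permutes_in_image[OF permutes_inv])
    then show ?thesis
      using * p by (simp add: permutes_inverses del: atLeastLessThan_iff)
  qed
  then show ?thesis
    unfolding design_iso_def using p by (blast intro: permutes_inv)
qed

text \<open>The identity outside \<open>Zn n\<close> is what \<open>permutes\<close>
  demands.\<close>

definition rot :: "nat \<Rightarrow> int \<Rightarrow> int" where
  "rot n x = (if x \<in> Zn n then (x + 1) mod int n else x)"

lemma rot_permutes: "rot n permutes Zn n"
proof (cases "n = 0")
  case False
  have "inj_on (rot n) (Zn n)"
  proof (rule inj_onI)
    fix x y assume xy: "x \<in> Zn n" "y \<in> Zn n" and "rot n x = rot n y"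
    then have "int n dvd (x + 1) - (y + 1)"
      by (simp only: rot_def if_True mod_eq_dvd_iff)
    then show "x = y"
      using Zn_eq_iff_dvd[OF xy] by simp
  qed
  moreover have "rot n ` Zn n \<subseteq> Zn n"
    using False by (auto simp: rot_def)
  ultimately have "bij_betw (rot n) (Zn n) (Zn n)"
    by (simp add: bij_betw_def endo_inj_surj)
  then show ?thesis
    by (rule bij_imp_permutes) (auto simp: rot_def)
qed (auto simp: rot_def permutes_def)

lemma design_iso_rot: "design_iso n S S (rot n)"
  unfolding design_iso_def
  by (intro conjI rot_permutes exI[of _ "rot n"]) (simp add: rot_def mod_simps)

lemma rot_funpow:
  "x \<in> Zn n \<Longrightarrow> (rot n ^^ m) x = (x + int m) mod int n"
proof (induction m)
  case (Suc m)
  have "n > 0" using Suc.prems by (cases n) auto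
  then have "(x + int m) mod int n \<in> Zn n" by simp
  then have "rot n ((x + int m) mod int n) = ((x + int m) mod int n + 1) mod int n"
    by (simp only: rot_def if_True)
  then show ?case
    using Suc by (simp add: mod_simps ac_simps)
qed simp

lemma rot_funpow_n: "rot n ^^ n = id"
proof
  fix x
  have "(rot n ^^ m) x = x" if "x \<notin> Zn n" for m
    by (induction m) (use that in \<open>auto simp: rot_def\<close>)
  then show "(rot n ^^ n) x = id x"
    by (cases "x \<in> Zn n") (auto simp: rot_funpow)
qed

text \<open>It suffices to follow the block of 0: \<theta> carries -S onto \<tau> 0 - T, so T = w S
  + (\<tau> 0 - c). Nothing has to be known about \<tau> at other points.\<close>

lemma affine_equiv_if_affine_design_iso:
  assumes n: "n > 0" and S: "S \<subseteq> Zn n" and T: "T \<subseteq> Zn n" and iso: "design_iso n S T \<theta>"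
    and w: "coprime w (int n)" and \<theta>: "\<And>x. x \<in> Zn n \<Longrightarrow> \<theta> x = (w * x + c) mod int n"
  shows "affine_equiv n S T"
proof -
  from iso obtain \<tau> where perm: "\<theta> permutes Zn n"
    and *: "\<And>x y. x \<in> Zn n \<Longrightarrow> y \<in> Zn n \<Longrightarrow> (y - x) mod int n \<in> S \<longleftrightarrow> (\<tau> y - \<theta> x) mod int n \<in> T"
    unfolding design_iso_def by blast
  define d where "d = \<tau> 0 - c"
  have 0: "0 \<in> Zn n" using n by simp
  have eq: "(\<tau> 0 - \<theta> x) mod int n = (w * ((0 - x) mod int n) + d) mod int n" if "x \<in> Zn n" for x
    by (simp only: \<theta>[OF that] mod_affine) (simp add: d_def mod_simps algebra_simps)
  have "T = (\<lambda>t. (w * t + d) mod int n) ` S"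
  proof (intro equalityI subsetI)
    fix s assume s: "s \<in> T"
    have "(\<tau> 0 - s) mod int n \<in> \<theta> ` Zn n"
      using n by (simp add: permutes_image[OF perm])
    then obtain x where x: "x \<in> Zn n" "\<theta> x = (\<tau> 0 - s) mod int n"
      by (metis imageE)
    have "(\<tau> 0 - \<theta> x) mod int n = s"
      using s T unfolding x(2) by (auto simp: mod_simps)
    then have "(0 - x) mod int n \<in> S" "s = (w * ((0 - x) mod int n) + d) mod int n"
      using *[OF x(1) 0] eq[OF x(1)] s by simp_all
    then show "s \<in> (\<lambda>t. (w * t + d) mod int n) ` S"
      by blast
  next
    fix s assume "s \<in> (\<lambda>t. (w * t + d) mod int n) ` S"
    then obtain t where t: "t \<in> S" "s = (w * t + d) mod int n" by blast
    define x where "x = (- t) mod int n"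
    have x: "x \<in> Zn n" using n by (simp add: x_def)
    have "(0 - x) mod int n = t"
      using t(1) S by (auto simp: x_def mod_simps)
    then show "s \<in> T"
      using *[OF x 0] eq[OF x] t by simp
  qed
  then show ?thesis
    unfolding affine_equiv_def using w by blast
qed

text \<open>
  Babai's argument: the rotation and its conjugate under the given isomorphism both generate
  subgroups of order p in the automorphism group of the design, whose order divides p!.
  Hence they are conjugate, and correcting the isomorphism by the conjugating automorphism
  makes it normalise the rotations, that is, affine.
\<close>

lemma design_iso_prime_imp_affine_equiv:
  assumes p: "Factorial_Ring.prime p" and S: "S \<subseteq> Zn p" and T: "T \<subseteq> Zn p" and \<sigma>: "design_iso p S T \<sigma>"
  shows "affine_equiv p S T"
proof -
  define P where "P = perm_group (Zn p)"
  define A where "A = {\<alpha>. design_iso p S S \<alpha>}"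
  define H where "H = P\<lparr>carrier := A\<rparr>"
  interpret P: group P unfolding P_def by (rule group_perm_group)
  have carP: "carrier P = {f. f permutes Zn p}" and multP: "\<And>f g. f \<otimes>\<^bsub>P\<^esub> g = f \<circ> g" and oneP: "\<one>\<^bsub>P\<^esub> = id"
    by (auto simp: P_def perm_group_def)
  have inv: "inv\<^bsub>P\<^esub> f = Hilbert_Choice.inv f" if "f permutes Zn p" for f
    using that by (intro P.inv_equality) (simp_all add: carP multP oneP permutes_inv permutes_inv_o)
  have sub: "subgroup A P"
  proof (rule subgroup.intro)
    show "A \<subseteq> carrier P" by (auto simp: A_def carP design_iso_def)
    show "x \<otimes>\<^bsub>P\<^esub> y \<in> A" if "x \<in> A" "y \<in> A" for x y
      using that unfolding A_def multP by (blast intro: design_iso_comp)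
    show "\<one>\<^bsub>P\<^esub> \<in> A" unfolding oneP A_def by (simp add: design_iso_id)
    show "inv\<^bsub>P\<^esub> x \<in> A" if "x \<in> A" for x
    proof -
      have "x permutes Zn p" using that by (simp add: A_def design_iso_def)
      then show ?thesis using that inv by (simp add: A_def design_iso_inv)
    qed
  qed
  interpret H: group H unfolding H_def by (rule subgroup.subgroup_is_group[OF sub P.is_group])
  have carH: "carrier H = A" and multH: "\<And>f g. f \<otimes>\<^bsub>H\<^esub> g = f \<circ> g" and oneH: "\<one>\<^bsub>H\<^esub> = id"
    by (auto simp: H_def multP oneP)
  have powH: "f [^]\<^bsub>H\<^esub> (m::nat) = f ^^ m" for f m
    unfolding H_def P_def by (rule perm_group_pow)
  have finP: "finite (carrier P)"
    by (simp add: carP finite_permutations)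
  have finA: "finite A"
    using sub finP by (meson finite_subset subgroup.subset)
  have "order P = fact p"
    by (simp add: P_def order_perm_group)
  then have "order H dvd fact p"
    using P.lagrange[OF sub] by (metis carH dvd_triv_right order_def)
  then have ndvd: "\<not> p\<^sup>2 dvd order H"
    using prime_square_not_dvd_fact[OF p] by (meson dvd_trans)
  have pgt: "p > 1" using p by (rule prime_gt_1_nat)
  let ?\<rho> = "rot p"
  have \<sigma>p: "\<sigma> permutes Zn p" using \<sigma> by (simp add: design_iso_def)
  \<comment> \<open>The rotation preserves the design of T as well; pulled back along \<sigma> it
    becomes an automorphism of the design of S.\<close>
  define k where "k = Hilbert_Choice.inv \<sigma> \<circ> ?\<rho> \<circ> \<sigma>"
  have \<rho>A: "?\<rho> \<in> A" by (simp add: A_def design_iso_rot)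
  have kA: "k \<in> A"
    unfolding A_def k_def using \<sigma> by (auto intro: design_iso_comp design_iso_inv design_iso_rot)
  have kpow: "k ^^ m = Hilbert_Choice.inv \<sigma> \<circ> ?\<rho> ^^ m \<circ> \<sigma>" for m
    by (induction m) (simp_all add: k_def fun_eq_iff permutes_inverses[OF \<sigma>p])
  have ord_p: "H.ord f = p" if "f \<in> A" "f ^^ p = id" "f \<noteq> id" for f
  proof -
    have "H.ord f dvd p"
      using that by (simp add: H.pow_eq_id[symmetric] carH powH oneH)
    moreover have "H.ord f \<noteq> 1"
      using that by (simp add: H.ord_eq_1 carH oneH del: One_nat_def)
    ultimately show ?thesis
      using p unfolding prime_nat_iff by blast
  qed
  have "?\<rho> 0 \<noteq> id 0"
    using pgt by (simp add: rot_def)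
  then have "?\<rho> \<noteq> id" by metis
  moreover have "k \<noteq> id"
  proof
    assume "k = id"
    then have "\<sigma> \<circ> k \<circ> Hilbert_Choice.inv \<sigma> = id"
      by (simp add: permutes_inv_o[OF \<sigma>p])
    moreover have "\<sigma> \<circ> k \<circ> Hilbert_Choice.inv \<sigma> = ?\<rho>"
      by (simp add: k_def fun_eq_iff permutes_inverses[OF \<sigma>p])
    ultimately show False using \<open>?\<rho> \<noteq> id\<close> by simp
  qed
  ultimately have "H.ord ?\<rho> = p" "H.ord k = p"
    using \<rho>A kA by (auto intro!: ord_p simp: kpow rot_funpow_n permutes_inv_o[OF \<sigma>p])
  then obtain a w where a: "a \<in> A" and "a \<otimes>\<^bsub>H\<^esub> k = ?\<rho> [^]\<^bsub>H\<^esub> (w::nat) \<otimes>\<^bsub>H\<^esub> a"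
    using H.prime_order_conj[of p ?\<rho> k] finA p ndvd \<rho>A kA unfolding carH by metis
  then have ak: "a (k x) = (?\<rho> ^^ w) (a x)" for x
    by (simp add: multH powH fun_eq_iff)
  \<comment> \<open>This runs from T back to S, and as a conjugates k to \<open>rot p ^^ w\<close>,
    it satisfies \<theta> (x + 1) = \<theta> x + w.\<close>
  define \<theta> where "\<theta> = a \<circ> Hilbert_Choice.inv \<sigma>"
  have \<theta>: "design_iso p T S \<theta>"
    unfolding \<theta>_def using a \<sigma> by (auto simp: A_def intro: design_iso_comp design_iso_inv)
  then have perm: "\<theta> permutes Zn p" by (simp add: design_iso_def)
  have step: "\<theta> (?\<rho> x) = (?\<rho> ^^ w) (\<theta> x)" for x
  proof -
    have "\<theta> (?\<rho> x) = a (k (Hilbert_Choice.inv \<sigma> x))"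
      by (simp add: \<theta>_def k_def permutes_inverses[OF \<sigma>p])
    then show ?thesis by (simp add: ak \<theta>_def)
  qed
  have \<theta>nat: "\<theta> (int m) = (int w * int m + \<theta> 0) mod int p" if "m < p" for m
    using that
  proof (induction m)
    case 0
    have "\<theta> 0 \<in> Zn p" using pgt permutes_in_image[OF perm, of 0] by simp
    then show ?case by simp
  next
    case (Suc m)
    have "\<theta> (int m) \<in> Zn p" using Suc.prems permutes_in_image[OF perm, of "int m"] by simp
    have "int (Suc m) = ?\<rho> (int m)" using Suc.prems by (simp add: rot_def)
    then have "\<theta> (int (Suc m)) = (\<theta> (int m) + int w) mod int p"
      using step rot_funpow[OF \<open>\<theta> (int m) \<in> Zn p\<close>] by simp
    then show ?case using Suc by (simp add: mod_simps algebra_simps)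
  qed
  have aff: "\<theta> x = (int w * x + \<theta> 0) mod int p" if "x \<in> Zn p" for x
    using \<theta>nat[of "nat x"] that by (simp add: nat_less_iff)
  have cop: "coprime (int w) (int p)"
  proof -
    \<comment> \<open>A slope divisible by p would give 0 and 1 the same image under the injective
      \<theta>.\<close>
    have "\<not> p dvd w"
    proof
      assume "p dvd w"
      then obtain j where "w = p * j" by (rule dvdE)
      then have "\<theta> (int 1) = \<theta> 0 mod int p"
        using \<theta>nat[of 1] pgt by simp
      also have "\<dots> = \<theta> (int 0)"
        using \<theta>nat[of 0] pgt by simp
      finally have "\<theta> (int 1) = \<theta> (int 0)" .
      then show False
        using injD[OF permutes_inj[OF perm], of "int 1" "int 0"] by simp
    qed
    then have "coprime p w"
      using p prime_imp_coprime by blast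
    then show ?thesis
      by (simp add: coprime_commute)
  qed
  have "p > 0" using pgt by simp
  then have "affine_equiv p T S"
    by (rule affine_equiv_if_affine_design_iso[OF _ T S \<theta> cop aff])
  then show ?thesis
    by (rule affine_equiv_sym[OF T])
qed

lemma haar_iso_if_design_iso:
  assumes "design_iso n S T \<sigma>"
  shows "haar_iso n S T"
proof -
  from assms obtain \<tau> where p: "\<sigma> permutes Zn n" "\<tau> permutes Zn n"
    and *: "\<forall>x\<in>Zn n. \<forall>y\<in>Zn n. (y - x) mod int n \<in> S \<longleftrightarrow> (\<tau> y - \<sigma> x) mod int n \<in> T"
    unfolding design_iso_def by blast
  define f where "f = (\<lambda>(x, i::nat). (if i = 1 then \<sigma> x else \<tau> x, i))"
  have V: "Zn n \<times> {1, 2::nat} = (\<lambda>x. (x, 1)) ` Zn n \<union> (\<lambda>x. (x, 2)) ` Zn n"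
    by auto
  have "f ` (Zn n \<times> {1, 2}) = (\<lambda>x. (x, 1)) ` \<sigma> ` Zn n \<union> (\<lambda>x. (x, 2)) ` \<tau> ` Zn n"
    unfolding V image_Un image_image by (simp add: f_def)
  then have "f ` (Zn n \<times> {1, 2}) = Zn n \<times> {1, 2}"
    unfolding V by (simp only: permutes_image[OF p(1)] permutes_image[OF p(2)])
  moreover have "inj_on f (Zn n \<times> {1, 2})"
  proof (rule inj_onI)
    fix u v assume eq: "f u = f v"
    obtain x i y j where uv: "u = (x, i)" "v = (y, j)" by (cases u; cases v)
    show "u = v"
      using eq injD[OF permutes_inj[OF p(1)], of x y] injD[OF permutes_inj[OF p(2)], of x y]
      by (cases "i = 1") (simp_all add: uv f_def split: if_splits)
  qed
  moreover have "haar_adj n S u v \<longleftrightarrow> haar_adj n T (f u) (f v)"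
    if "u \<in> Zn n \<times> {1, 2}" "v \<in> Zn n \<times> {1, 2}" for u v
  proof -
    obtain x i y j where uv: "u = (x, i)" "v = (y, j)" by (cases u; cases v)
    then have xy: "x \<in> Zn n" "y \<in> Zn n" using that by simp_all
    have 1: "(y - x) mod int n \<in> S \<longleftrightarrow> (\<tau> y - \<sigma> x) mod int n \<in> T"
      using * xy by (simp del: atLeastLessThan_iff)
    have 2: "(x - y) mod int n \<in> S \<longleftrightarrow> (\<tau> x - \<sigma> y) mod int n \<in> T"
      using * xy by (simp del: atLeastLessThan_iff)
    show ?thesis
      unfolding haar_adj_def uv f_def fst_conv snd_conv case_prod_conv 1 2 by auto
  qed
  ultimately show ?thesis
    unfolding haar_iso_def bij_betw_def by blast
qed

text \<open>Multiply by a on both parts and shift only the second by b: differences y - x then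
  become a (y - x) + b.\<close>

lemma haar_iso_if_affine_equiv:
  assumes n: "n > 0" and S: "S \<subseteq> Zn n" and "affine_equiv n S T"
  shows "haar_iso n S T"
proof -
  from assms obtain a b where a: "coprime a (int n)" and T: "T = (\<lambda>x. (a * x + b) mod int n) ` S"
    unfolding affine_equiv_def by blast
  define g where "g b x = (if x \<in> Zn n then (a * x + b) mod int n else x)" for b x
  have perm: "g b permutes Zn n" for b
  proof -
    have "inj_on (g b) (Zn n)"
      using affine_inj_on[OF a] by (rule iffD1[OF inj_on_cong, rotated]) (simp add: g_def)
    moreover have "g b ` Zn n \<subseteq> Zn n"
      using n by (auto simp: g_def)
    ultimately have "bij_betw (g b) (Zn n) (Zn n)"
      by (simp add: bij_betw_def endo_inj_surj)
    then show ?thesis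
      by (rule bij_imp_permutes) (simp only: g_def if_False)
  qed
  have "(y - x) mod int n \<in> S \<longleftrightarrow> (g b y - g 0 x) mod int n \<in> T"
    if "x \<in> Zn n" "y \<in> Zn n" for x y
  proof -
    let ?d = "(y - x) mod int n"
    have "(g b y - g 0 x) mod int n = (a * (y - x) + b) mod int n"
      using that by (simp add: g_def mod_simps algebra_simps)
    then have eq: "(g b y - g 0 x) mod int n = (a * ?d + b) mod int n"
      by (simp only: mod_affine)
    show ?thesis
    proof
      assume "(g b y - g 0 x) mod int n \<in> T"
      then obtain s where s: "s \<in> S" "(a * ?d + b) mod int n = (a * s + b) mod int n"
        unfolding eq T by blast
      then have "int n dvd a * (?d - s)"
        by (simp add: mod_eq_dvd_iff algebra_simps)
      then have "int n dvd ?d - s"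
        by (rule coprime_dvd_cancel[OF a])
      moreover have "?d \<in> Zn n" "s \<in> Zn n"
        using n s(1) S by auto
      ultimately have "?d = s"
        by (simp only: Zn_eq_iff_dvd)
      then show "?d \<in> S" using s by simp
    next
      assume "?d \<in> S"
      then show "(g b y - g 0 x) mod int n \<in> T"
        unfolding eq T by blast
    qed
  qed
  then have "design_iso n S T (g 0)"
    unfolding design_iso_def using perm by blast
  then show ?thesis
    by (rule haar_iso_if_design_iso)
qed

text \<open>
  A difference of two elements of S that is a unit makes the graph connected, so an isomorphism
  either preserves or swaps the two parts.
\<close>

lemma design_iso_if_haar_iso:
  assumes n: "n > 0" and S: "S \<subseteq> Zn n" and T: "T \<subseteq> Zn n" and iso: "haar_iso n S T"
    and s: "s \<in> S" "s' \<in> S" and cop: "coprime (s - s') (int n)"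
  obtains \<sigma> where "design_iso n S T \<sigma> \<or> design_iso n S ((\<lambda>x. (- x) mod int n) ` T) \<sigma>"
proof -
  let ?V = "Zn n \<times> {1, 2::nat}"
  from iso obtain f where f: "bij_betw f ?V ?V"
    and adj: "\<And>u v. u \<in> ?V \<Longrightarrow> v \<in> ?V \<Longrightarrow> haar_adj n S u v \<longleftrightarrow> haar_adj n T (f u) (f v)"
    unfolding haar_iso_def by blast
  have fV: "f u \<in> ?V" if "u \<in> ?V" for u
    using bij_betw_apply[OF f that] .
  \<comment> \<open>The map i to 3 - i exchanges the part labels 1 and 2.\<close>
  have flip: "snd (f (y, 2)) = 3 - snd (f (x, 1))"
    if xy: "x \<in> Zn n" "y \<in> Zn n" "(y - x) mod int n \<in> S" for x y
  proof -
    have "haar_adj n S (x, 1) (y, 2)"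
      using xy by (simp add: haar_adj_def)
    then have "haar_adj n T (f (x, 1)) (f (y, 2))"
      using adj[of "(x, 1)" "(y, 2)"] xy by simp
    then show ?thesis
      by (auto simp: haar_adj_def)
  qed
  have nbr: "snd (f (x, 1)) = 3 - snd (f (y, 2))" "(y - x) mod int n = t"
    if "t \<in> S" "y \<in> Zn n" "x = (y - t) mod int n" for x y t
  proof -
    have "x \<in> Zn n" using n that by simp
    have "t mod int n = t" using S that(1) by auto
    then show t: "(y - x) mod int n = t"
      using that(3) by (simp add: mod_simps)
    then have "snd (f (y, 2)) = 3 - snd (f (x, 1))"
      using that \<open>x \<in> Zn n\<close> by (intro flip) simp_all
    moreover have "snd (f (x, 1)) \<in> {1, 2}"
      using fV[of "(x, 1)"] \<open>x \<in> Zn n\<close> by (auto simp: mem_Times_iff)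
    ultimately show "snd (f (x, 1)) = 3 - snd (f (y, 2))" by auto
  qed
  \<comment> \<open>The part into which the vertex (x, 1) is mapped, extended periodically to all
    integers.\<close>
  define c where "c x = snd (f (x mod int n, 1))" for x
  \<comment> \<open>Both (x, 1) and (x + s - s', 1) are adjacent to (x + s, 2), so their images lie
    in the same part.\<close>
  have c_step: "c (x + (s - s')) = c x" for x
  proof -
    have y: "(x + s) mod int n \<in> Zn n" using n by simp
    have "x mod int n = ((x + s) mod int n - s) mod int n"
      "(x + (s - s')) mod int n = ((x + s) mod int n - s') mod int n"
      by (simp_all add: mod_simps algebra_simps)
    then show ?thesis
      unfolding c_def using nbr(1)[OF s(1) y] nbr(1)[OF s(2) y] by simp
  qed
  have c_steps: "c (x + int m * (s - s')) = c x" for x m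
  proof (induction m)
    case (Suc m)
    have "x + int (Suc m) * (s - s') = (x + int m * (s - s')) + (s - s')"
      by (simp add: algebra_simps)
    then show ?case by (simp only: c_step Suc.IH)
  qed simp
  \<comment> \<open>As s - s' is a unit, every residue is reached from 0 by steps of this
    length.\<close>
  have c_const: "c x = c 0" for x
  proof -
    obtain z where z: "[(s - s') * z = 1] (mod int n)"
      using cong_solve_coprime_int[OF cop] by blast
    define m where "m = nat ((z * x) mod int n)"
    have "int m = (z * x) mod int n" using n by (simp add: m_def)
    then have "(0 + int m * (s - s')) mod int n = (((s - s') * z) * x) mod int n"
      by (simp add: mod_simps ac_simps)
    also have "\<dots> = x mod int n"
      using cong_mult[OF z cong_refl[of x]] by (simp add: cong_def)
    finally have "c x = c (0 + int m * (s - s'))"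
      unfolding c_def by simp
    then show ?thesis by (simp only: c_steps)
  qed
  have part1: "snd (f (x, 1)) = c 0" if "x \<in> Zn n" for x
    using c_const[of x] that by (simp add: c_def)
  have part2: "snd (f (y, 2)) = 3 - c 0" if "y \<in> Zn n" for y
  proof -
    define x where "x = (y - s) mod int n"
    have "x \<in> Zn n" using n by (simp add: x_def)
    moreover have "(y - x) mod int n \<in> S"
      using nbr(2)[OF s(1) that x_def] s(1) by simp
    ultimately show ?thesis
      using flip[OF _ that] part1 by simp
  qed
  have perm: "(\<lambda>x. if x \<in> Zn n then fst (f (x, i)) else x) permutes Zn n"
    if i: "i \<in> {1, 2}" and const: "\<And>x. x \<in> Zn n \<Longrightarrow> snd (f (x, i)) = d" for i d
  proof (rule bij_imp_permutes)
    have "inj_on (\<lambda>x. fst (f (x, i))) (Zn n)"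
    proof (rule inj_onI)
      fix x y assume xy: "x \<in> Zn n" "y \<in> Zn n" "fst (f (x, i)) = fst (f (y, i))"
      then have "f (x, i) = f (y, i)"
        using const by (simp add: prod_eq_iff)
      then show "x = y"
        using bij_betw_imp_inj_on[OF f] xy i by (auto dest: inj_onD)
    qed
    moreover have "(\<lambda>x. fst (f (x, i))) ` Zn n \<subseteq> Zn n"
      using fV i by (force simp: mem_Times_iff)
    ultimately have "bij_betw (\<lambda>x. fst (f (x, i))) (Zn n) (Zn n)"
      by (simp add: bij_betw_def endo_inj_surj)
    then show "bij_betw (\<lambda>x. if x \<in> Zn n then fst (f (x, i)) else x) (Zn n) (Zn n)"
      by (rule iffD1[OF bij_betw_cong, rotated]) simp
  qed auto
  define \<sigma> where "\<sigma> = (\<lambda>x. if x \<in> Zn n then fst (f (x, 1)) else x)"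
  define \<tau> where "\<tau> = (\<lambda>x. if x \<in> Zn n then fst (f (x, 2)) else x)"
  have perms: "\<sigma> permutes Zn n" "\<tau> permutes Zn n"
    unfolding \<sigma>_def \<tau>_def using perm[OF _ part1] perm[OF _ part2] by simp_all
  have edge: "(y - x) mod int n \<in> S \<longleftrightarrow>
      (if c 0 = 1 then (\<tau> y - \<sigma> x) mod int n \<in> T else (\<sigma> x - \<tau> y) mod int n \<in> T)"
    if "x \<in> Zn n" "y \<in> Zn n" for x y
  proof -
    have "c 0 \<in> {1, 2}"
      using fV[of "(0, 1)"] n by (auto simp: c_def mem_Times_iff)
    have "(y - x) mod int n \<in> S \<longleftrightarrow> haar_adj n S (x, 1) (y, 2)"
      by (simp add: haar_adj_def)
    also have "\<dots> \<longleftrightarrow> haar_adj n T (f (x, 1)) (f (y, 2))"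
      using that by (intro adj) auto
    also have "\<dots> \<longleftrightarrow> haar_adj n T (\<sigma> x, c 0) (\<tau> y, 3 - c 0)"
      using that part1[of x] part2[of y] by (simp add: haar_adj_def \<sigma>_def \<tau>_def)
    also have "\<dots> \<longleftrightarrow>
      (if c 0 = 1 then (\<tau> y - \<sigma> x) mod int n \<in> T else (\<sigma> x - \<tau> y) mod int n \<in> T)"
      using \<open>c 0 \<in> {1, 2}\<close> by (auto simp: haar_adj_def)
    finally show ?thesis .
  qed
  \<comment> \<open>When the parts are exchanged, an edge of the image is read backwards and its
    difference changes sign, so T is replaced by -T.\<close>
  have neg: "(- z) mod int n \<in> T \<longleftrightarrow> z mod int n \<in> (\<lambda>x. (- x) mod int n) ` T" for z
  proof
    assume "z mod int n \<in> (\<lambda>x. (- x) mod int n) ` T"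
    then obtain t where t: "t \<in> T" "z mod int n = (- t) mod int n" by blast
    then have "(- z) mod int n = (- (- t)) mod int n" by (metis mod_minus_eq)
    then show "(- z) mod int n \<in> T" using t(1) T by auto
  qed (force simp: mod_simps intro: image_eqI[of _ _ "(- z) mod int n"])
  show thesis
  proof (rule that, cases "c 0 = 1")
    case True
    then have "design_iso n S T \<sigma>"
      unfolding design_iso_def using perms edge by (intro conjI exI[of _ \<tau>]) auto
    then show "design_iso n S T \<sigma> \<or> design_iso n S ((\<lambda>x. (- x) mod int n) ` T) \<sigma>" ..
  next
    case False
    then have "(y - x) mod int n \<in> S \<longleftrightarrow> (\<tau> y - \<sigma> x) mod int n \<in> (\<lambda>x. (- x) mod int n) ` T"
      if "x \<in> Zn n" "y \<in> Zn n" for x y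
      using edge[OF that] neg[of "\<tau> y - \<sigma> x"] by simp
    then have "design_iso n S ((\<lambda>x. (- x) mod int n) ` T) \<sigma>"
      unfolding design_iso_def using perms by blast
    then show "design_iso n S T \<sigma> \<or> design_iso n S ((\<lambda>x. (- x) mod int n) ` T) \<sigma>" ..
  qed
qed

section \<open>Triangles of vertices with equally many common neighbours\<close>

definition common_nbrs :: "nat \<Rightarrow> int set \<Rightarrow> int \<times> nat \<Rightarrow> int \<times> nat \<Rightarrow> nat" where
  "common_nbrs n S u v = card {w \<in> Zn n \<times> {1, 2}. haar_adj n S u w \<and> haar_adj n S v w}"

definition common_nbr_triangles :: "nat \<Rightarrow> int set \<Rightarrow> nat \<Rightarrow> int \<times> nat \<Rightarrow> nat" where
  "common_nbr_triangles n S c u = card {(v, w) \<in> (Zn n \<times> {1, 2}) \<times> (Zn n \<times> {1, 2}).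
    common_nbrs n S u v = c \<and> common_nbrs n S u w = c \<and> common_nbrs n S v w = c}"

definition overlap :: "nat \<Rightarrow> int set \<Rightarrow> int \<Rightarrow> nat" where
  "overlap n S d = card {s \<in> S. (s + d) mod int n \<in> S}"

text \<open>For D closed under negation this is the number of closed walks of length 3 at a vertex
  of the Cayley graph of Z_n with connection set D.\<close>

definition triangles :: "nat \<Rightarrow> int set \<Rightarrow> nat" where
  "triangles n D = card {(d, e) \<in> D \<times> D. (e - d) mod int n \<in> D}"

definition overlap_triangles :: "nat \<Rightarrow> int set \<Rightarrow> nat \<Rightarrow> nat" where
  "overlap_triangles n S c = triangles n {d \<in> Zn n. overlap n S d = c}"

text \<open>A common neighbour w corresponds to s = w - x in the first part and to s = y - w in the
  second. These choices lead to the same shift x - y in both cases, so the count does not reveal the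
  part.\<close>

lemma common_nbrs_eq_overlap:
  assumes n: "n > 0" and S: "S \<subseteq> Zn n" and i: "i \<in> {1, 2}"
    and xy: "x \<in> Zn n" "y \<in> Zn n"
  shows "common_nbrs n S (x, i) (y, i) = overlap n S ((x - y) mod int n)"
proof (cases "i = 1")
  case True
  let ?W = "{w \<in> Zn n \<times> {1, 2}. haar_adj n S (x, i) w \<and> haar_adj n S (y, i) w}"
  let ?O = "{s \<in> S. (s + (x - y) mod int n) mod int n \<in> S}"
  have "bij_betw (\<lambda>w. (fst w - x) mod int n) ?W ?O"
  proof (rule bij_betw_byWitness[where f' = "\<lambda>s. ((s + x) mod int n, 2)"])
    show "\<forall>w\<in>?W. (((fst w - x) mod int n + x) mod int n, 2) = w"
      using True by (auto simp: haar_adj_def mod_simps)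
    show "\<forall>s\<in>?O. (fst ((s + x) mod int n, 2::nat) - x) mod int n = s"
      using S by (auto simp: mod_simps)
    show "(\<lambda>w. (fst w - x) mod int n) ` ?W \<subseteq> ?O"
      using True by (auto simp: haar_adj_def mod_simps)
    show "(\<lambda>s. ((s + x) mod int n, 2)) ` ?O \<subseteq> ?W"
      using True n S by (auto simp: haar_adj_def mod_simps algebra_simps)
  qed
  then show ?thesis
    unfolding common_nbrs_def overlap_def by (rule bij_betw_same_card)
next
  case False
  then have i: "i = 2" using i by simp
  let ?W = "{w \<in> Zn n \<times> {1, 2}. haar_adj n S (x, i) w \<and> haar_adj n S (y, i) w}"
  let ?O = "{s \<in> S. (s + (x - y) mod int n) mod int n \<in> S}"
  have "bij_betw (\<lambda>w. (y - fst w) mod int n) ?W ?O"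
  proof (rule bij_betw_byWitness[where f' = "\<lambda>s. ((y - s) mod int n, 1)"])
    show "\<forall>w\<in>?W. ((y - (y - fst w) mod int n) mod int n, 1) = w"
      using i by (auto simp: haar_adj_def mod_simps)
    show "\<forall>s\<in>?O. (y - fst ((y - s) mod int n, 1::nat)) mod int n = s"
      using S by (auto simp: mod_simps)
    show "(\<lambda>w. (y - fst w) mod int n) ` ?W \<subseteq> ?O"
      using i by (auto simp: haar_adj_def mod_simps)
    show "(\<lambda>s. ((y - s) mod int n, 1)) ` ?O \<subseteq> ?W"
      using i n S by (auto simp: haar_adj_def mod_simps algebra_simps)
  qed
  then show ?thesis
    unfolding common_nbrs_def overlap_def by (rule bij_betw_same_card)
qed

lemma common_nbrs_pos_imp_same_part:
  assumes "common_nbrs n S u v > 0" shows "snd u = snd v"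
proof -
  have "{w \<in> Zn n \<times> {1, 2}. haar_adj n S u w \<and> haar_adj n S v w} \<noteq> {}"
    using assms unfolding common_nbrs_def by (metis card.empty less_irrefl)
  then show ?thesis by (auto simp: haar_adj_def)
qed

text \<open>Since c > 0, both v and w lie in the part of u = (x, i). Writing their first components
  as x - d and x - e turns the three conditions into overlaps at d, e and e - d.\<close>

lemma common_nbr_triangles_eq:
  assumes n: "n > 0" and S: "S \<subseteq> Zn n" and c: "c > 0" and u: "u \<in> Zn n \<times> {1, 2}"
  shows "common_nbr_triangles n S c u = overlap_triangles n S c"
proof -
  obtain x i where ui: "u = (x, i)" and x: "x \<in> Zn n" and i: "i \<in> {1, 2}"
    using u by (cases u) auto
  let ?V = "Zn n \<times> {1, 2::nat}"
  let ?A = "{(v, w) \<in> ?V \<times> ?V.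
    common_nbrs n S u v = c \<and> common_nbrs n S u w = c \<and> common_nbrs n S v w = c}"
  define D where "D = {d \<in> Zn n. overlap n S d = c}"
  let ?B = "{(d, e) \<in> D \<times> D. (e - d) mod int n \<in> D}"
  let ?g = "\<lambda>(d, e). (((x - d) mod int n, i), ((x - e) mod int n, i))"
  have invol: "(x - (x - d) mod int n) mod int n = d" if "d \<in> Zn n" for d
    using that by (simp add: mod_simps)
  have cn: "common_nbrs n S u ((x - d) mod int n, i) = overlap n S d" if "d \<in> Zn n" for d
    unfolding ui using common_nbrs_eq_overlap[OF n S i x, of "(x - d) mod int n"] n invol[OF that] by simp
  have cn2: "common_nbrs n S ((x - d) mod int n, i) ((x - e) mod int n, i) =
      overlap n S ((e - d) mod int n)" for d e
    using common_nbrs_eq_overlap[OF n S i, of "(x - d) mod int n" "(x - e) mod int n"] n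
    by (simp add: mod_simps)
  have img: "?g ` ?B = ?A"
  proof (intro equalityI subsetI)
    fix z assume "z \<in> ?g ` ?B"
    then obtain d e where "d \<in> D" "e \<in> D" "(e - d) mod int n \<in> D"
      and z: "z = (((x - d) mod int n, i), ((x - e) mod int n, i))"
      by auto
    then show "z \<in> ?A"
      using n i cn cn2 by (auto simp: D_def)
  next
    fix z assume "z \<in> ?A"
    then obtain v w where z: "z = (v, w)" and vw: "v \<in> ?V" "w \<in> ?V"
      and cs: "common_nbrs n S u v = c" "common_nbrs n S u w = c" "common_nbrs n S v w = c"
      by auto
    have "snd v = i" "snd w = i"
      using common_nbrs_pos_imp_same_part[of n S u v] common_nbrs_pos_imp_same_part[of n S u w] cs c
      by (simp_all add: ui)
    then obtain y y' where y: "v = (y, i)" "w = (y', i)" "y \<in> Zn n" "y' \<in> Zn n"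
      using vw by (cases v; cases w) auto
    define d e where "d = (x - y) mod int n" and "e = (x - y') mod int n"
    have de: "d \<in> Zn n" "e \<in> Zn n" "y = (x - d) mod int n" "y' = (x - e) mod int n"
      using n invol[OF y(3)] invol[OF y(4)] by (simp_all add: d_def e_def)
    have "(d, e) \<in> ?B"
      using de cs cn[OF de(1)] cn[OF de(2)] cn2[of d e] n y(1,2) by (simp add: D_def)
    moreover have "z = ?g (d, e)"
      by (simp only: z y(1,2) case_prod_conv de(3,4)[symmetric])
    ultimately show "z \<in> ?g ` ?B"
      by (rule rev_image_eqI)
  qed
  have "inj_on ?g ?B"
  proof (rule inj_onI)
    fix z z' assume zz: "z \<in> ?B" "z' \<in> ?B" "?g z = ?g z'"
    obtain d e d' e' where de: "z = (d, e)" "z' = (d', e')" by (cases z; cases z')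
    have "d \<in> Zn n" "e \<in> Zn n" "d' \<in> Zn n" "e' \<in> Zn n"
      using zz(1,2) by (simp_all add: de D_def)
    moreover have "(x - d) mod int n = (x - d') mod int n" "(x - e) mod int n = (x - e') mod int n"
      using zz(3) by (simp_all add: de)
    ultimately show "z = z'"
      unfolding de by (metis invol)
  qed
  then have "card (?g ` ?B) = card ?B"
    by (rule card_image)
  then show ?thesis
    unfolding common_nbr_triangles_def overlap_triangles_def triangles_def D_def[symmetric]
    by (simp only: img)
qed

text \<open>The count at (0, 1) is carried to the count at its image. That image may be any vertex
  of either part, but the count is the same at all of them. The overlap at shift 0 is the degree,
  which gives the cardinality.\<close>

lemma
  assumes n: "n > 0" and S: "S \<subseteq> Zn n" and T: "T \<subseteq> Zn n" and iso: "haar_iso n S T"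
  shows haar_iso_imp_card_eq: "card S = card T"
    and haar_iso_imp_overlap_triangles_eq: "c > 0 \<Longrightarrow> overlap_triangles n S c = overlap_triangles n T c"
proof -
  let ?V = "Zn n \<times> {1, 2::nat}"
  from iso obtain f where f: "bij_betw f ?V ?V"
    and adj: "\<And>u v. u \<in> ?V \<Longrightarrow> v \<in> ?V \<Longrightarrow> haar_adj n S u v \<longleftrightarrow> haar_adj n T (f u) (f v)"
    unfolding haar_iso_def by blast
  have inj: "inj_on f ?V" and img: "f ` ?V = ?V"
    using f by (auto simp: bij_betw_def)
  have fV: "f u \<in> ?V" if "u \<in> ?V" for u
    using bij_betw_apply[OF f that] .
  have cn: "common_nbrs n S u v = common_nbrs n T (f u) (f v)" if uv: "u \<in> ?V" "v \<in> ?V" for u v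
  proof -
    let ?W = "{w \<in> ?V. haar_adj n S u w \<and> haar_adj n S v w}"
    have "f ` ?W = {w \<in> f ` ?V. haar_adj n T (f u) w \<and> haar_adj n T (f v) w}"
      using adj uv by blast
    moreover have "card (f ` ?W) = card ?W"
      by (rule card_image) (rule inj_on_subset[OF inj], blast)
    ultimately show ?thesis
      unfolding common_nbrs_def img by simp
  qed
  have u0: "(0, 1) \<in> ?V" using n by simp
  have ov0: "overlap n X 0 = card X" if "X \<subseteq> Zn n" for X
  proof -
    have "{s \<in> X. (s + 0) mod int n \<in> X} = X" using that by auto
    then show ?thesis by (simp add: overlap_def)
  qed
  have deg: "common_nbrs n X u u = card X" if "u \<in> ?V" "X \<subseteq> Zn n" for u X
    using that common_nbrs_eq_overlap[OF n that(2), of "snd u" "fst u" "fst u"] ov0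
    by (simp add: mem_Times_iff)
  show "card S = card T"
    using cn[OF u0 u0] deg[OF u0 S] deg[OF fV[OF u0] T] by simp
  show "overlap_triangles n S c = overlap_triangles n T c" if "c > 0"
  proof -
    let ?P = "{(v, w) \<in> ?V \<times> ?V. common_nbrs n S (0, 1) v = c \<and>
      common_nbrs n S (0, 1) w = c \<and> common_nbrs n S v w = c}"
    let ?Q = "{(v, w) \<in> ?V \<times> ?V. common_nbrs n T (f (0, 1)) v = c \<and>
      common_nbrs n T (f (0, 1)) w = c \<and> common_nbrs n T v w = c}"
    have mem: "(f v, f w) \<in> ?Q \<longleftrightarrow> (v, w) \<in> ?P" if "v \<in> ?V" "w \<in> ?V" for v w
      using cn[OF u0 that(1)] cn[OF u0 that(2)] cn[OF that] that fV[OF that(1)] fV[OF that(2)]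
      by (simp only: mem_Collect_eq case_prod_conv mem_Sigma_iff)
    have img_P: "map_prod f f ` ?P = ?Q"
    proof (intro equalityI subsetI)
      fix z assume "z \<in> map_prod f f ` ?P"
      then obtain v w where vw: "(v, w) \<in> ?P" "z = (f v, f w)" by auto
      then have "v \<in> ?V" "w \<in> ?V" by simp_all
      then show "z \<in> ?Q" using vw mem[of v w] by (simp only:)
    next
      fix z assume z: "z \<in> ?Q"
      then have "z \<in> f ` ?V \<times> f ` ?V"
        unfolding img by auto
      then obtain v w where vw: "v \<in> ?V" "w \<in> ?V" "z = (f v, f w)"
        by blast
      then have "(v, w) \<in> ?P"
        using mem[of v w] z by (simp only:)
      moreover have "z = map_prod f f (v, w)"
        using vw(3) by (simp only: map_prod_simp)
      ultimately show "z \<in> map_prod f f ` ?P"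
        by (rule rev_image_eqI)
    qed
    have "inj_on (map_prod f f) ?P"
      by (rule inj_on_subset[OF map_prod_inj_on[OF inj inj]]) blast
    then have "card (map_prod f f ` ?P) = card ?P"
      by (rule card_image)
    then have "common_nbr_triangles n S c (0, 1) = common_nbr_triangles n T c (f (0, 1))"
      unfolding common_nbr_triangles_def by (simp only: img_P)
    then show ?thesis
      using common_nbr_triangles_eq[OF n S that u0] common_nbr_triangles_eq[OF n T that fV[OF u0]]
      by simp
  qed
qed

text \<open>Distinct residues modulo a prime differ by a unit, so two elements of S suffice for the
  connectivity argument; smaller sets are determined up to translation by their size.\<close>

lemma haar_iso_prime_imp_affine_equiv:
  assumes p: "Factorial_Ring.prime p" and S: "S \<subseteq> Zn p" and T: "T \<subseteq> Zn p" and iso: "haar_iso p S T"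
  shows "affine_equiv p S T"
proof (cases "\<exists>s\<in>S. \<exists>s'\<in>S. s \<noteq> s'")
  case True
  then obtain s s' where s: "s \<in> S" "s' \<in> S" "s \<noteq> s'" by blast
  have "p > 0" using p by (rule prime_gt_0_nat)
  have "\<not> int p dvd s - s'"
    using s S Zn_eq_iff_dvd[of s p s'] by blast
  then have "coprime (s - s') (int p)"
    using p by (metis coprime_commute prime_imp_coprime prime_nat_int_transfer)
  then obtain \<sigma> where "design_iso p S T \<sigma> \<or> design_iso p S ((\<lambda>x. (- x) mod int p) ` T) \<sigma>"
    using design_iso_if_haar_iso[OF \<open>p > 0\<close> S T iso s(1,2)] by blast
  then show ?thesis
  proof
    assume \<sigma>: "design_iso p S ((\<lambda>x. (- x) mod int p) ` T) \<sigma>"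
    have sub: "(\<lambda>x. (- x) mod int p) ` T \<subseteq> Zn p"
      using \<open>p > 0\<close> by auto
    have "affine_equiv p T ((\<lambda>x. (- x) mod int p) ` T)"
      unfolding affine_equiv_def by (rule exI[of _ "-1"], rule exI[of _ 0]) simp
    then have "affine_equiv p ((\<lambda>x. (- x) mod int p) ` T) T"
      by (rule affine_equiv_sym[OF T])
    with design_iso_prime_imp_affine_equiv[OF p S sub \<sigma>] show ?thesis
      by (rule affine_equiv_trans)
  qed (rule design_iso_prime_imp_affine_equiv[OF p S T])
next
  case False
  have card: "card S = card T"
    using haar_iso_imp_card_eq[OF prime_gt_0_nat[OF p] S T iso] .
  have fin: "finite S" "finite T"
    using S T finite_subset by blast+
  show ?thesis
  proof (cases "S = {}")
    case True
    then show ?thesis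
      using card fin by (auto simp: affine_equiv_def intro!: exI[of _ 1])
  next
    case nonempty: False
    then obtain s where S_eq: "S = {s}" using False by blast
    then obtain t where "T = {t}" using card by (metis card_1_singletonE card_1_singleton_iff)
    then have T_eq: "T = (\<lambda>x. (1 * x + (t - s)) mod int p) ` S"
      using S_eq T by simp
    show ?thesis
      unfolding affine_equiv_def
      by (rule exI[of _ 1], rule exI[of _ "t - s"]) (use T_eq in simp)
  qed
qed

section \<open>Orders 4 and 9\<close>

text \<open>
  The simplifier evaluates both arguments of a disjunction but only one branch of a conditional,
  hence the conditionals instead of connectives in the functions below.
\<close>

fun ex_lazy :: "('a \<Rightarrow> bool) \<Rightarrow> 'a list \<Rightarrow> bool" where
  "ex_lazy P [] \<longleftrightarrow> False"
| "ex_lazy P (x # xs) \<longleftrightarrow> (if P x then True else ex_lazy P xs)"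

fun maps_into :: "int \<Rightarrow> int \<Rightarrow> int \<Rightarrow> int list \<Rightarrow> int list \<Rightarrow> bool" where
  "maps_into n a b T [] \<longleftrightarrow> True"
| "maps_into n a b T (x # xs) \<longleftrightarrow> (if (a * x + b) mod n \<in> set T then maps_into n a b T xs else False)"

definition has_affine_rep :: "int \<Rightarrow> int list list \<Rightarrow> int list \<Rightarrow> int list \<Rightarrow> bool" where
  "has_affine_rep n reps units T \<longleftrightarrow> ex_lazy (\<lambda>R. if length R = length T
    then ex_lazy (\<lambda>a. ex_lazy (\<lambda>b. maps_into n a b T R) [0..n - 1]) units else False) reps"

text \<open>
  By induction on the cardinality, it suffices that adding one point to a representative yields
  an affine image of a representative.
\<close>

definition closed_reps :: "int \<Rightarrow> int list list \<Rightarrow> int list \<Rightarrow> bool" where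
  "closed_reps n reps units \<longleftrightarrow> (\<forall>R\<in>set reps. \<forall>x\<in>set [0..n - 1].
    if x \<in> set R then True else has_affine_rep n reps units (x # R))"

definition overlap_list :: "int \<Rightarrow> int list \<Rightarrow> int \<Rightarrow> nat" where
  "overlap_list n R d = length (filter (\<lambda>s. (s + d) mod n \<in> set R) R)"

definition triangles_list :: "int \<Rightarrow> int list \<Rightarrow> nat" where
  "triangles_list n D = length (filter (\<lambda>(d, e). (e - d) mod n \<in> set D) (List.product D D))"

text \<open>The range is c = 1, ..., n: the value 0 says nothing about the parts, and no overlap
  exceeds n.\<close>

definition profile :: "int \<Rightarrow> int list \<Rightarrow> nat list" where
  "profile n R = map (\<lambda>c. triangles_list n (filter (\<lambda>d. overlap_list n R d = c) [0..n - 1])) [1..<nat n + 1]"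

definition reps4 :: "int list list" where
  "reps4 = [[], [0], [0, 1], [0, 2], [0, 1, 2], [0, 1, 2, 3]]"

text \<open>One set for each of the 22 affine classes modulo 9: closure under adding a point shows
  that every class is met, distinct profiles that none is met twice.\<close>

definition reps9 :: "int list list" where
  "reps9 = [[], [0], [0, 1], [0, 3], [0, 1, 2], [0, 1, 3], [0, 3, 6],
    [0, 1, 2, 3], [0, 1, 2, 4], [0, 1, 3, 4], [0, 1, 3, 6],
    [0, 1, 2, 3, 4], [0, 1, 2, 3, 5], [0, 1, 2, 3, 6], [0, 1, 3, 4, 6],
    [0, 1, 2, 3, 4, 5], [0, 1, 2, 3, 4, 6], [0, 1, 3, 4, 6, 7],
    [0, 1, 2, 3, 4, 5, 6], [0, 1, 2, 3, 4, 6, 7],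
    [0, 1, 2, 3, 4, 5, 6, 7], [0, 1, 2, 3, 4, 5, 6, 7, 8]]"


lemma closed_reps4: "closed_reps 4 reps4 [1, 3]" by code_simp
lemma distinct_profile4: "distinct (map (profile 4) reps4)" by code_simp
lemma distinct_profile9: "distinct (map (profile 9) reps9)" by code_simp
lemma closed_reps9: "closed_reps 9 reps9 [1, 2, 4, 5, 7, 8]" by code_simp

lemma ex_lazy_iff: "ex_lazy P xs \<longleftrightarrow> (\<exists>x\<in>set xs. P x)"
  by (induction xs) auto

lemma maps_into_iff: "maps_into n a b T xs \<longleftrightarrow> (\<forall>x\<in>set xs. (a * x + b) mod n \<in> set T)"
  by (induction xs) auto

lemma has_affine_repD:
  assumes rep: "has_affine_rep (int n) reps units T" and T: "distinct T"
    and units: "\<forall>a\<in>set units. coprime a (int n)"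
    and reps: "\<forall>R\<in>set reps. distinct R \<and> set R \<subseteq> Zn n"
  shows "\<exists>R\<in>set reps. affine_equiv n (set R) (set T)"
proof -
  from rep obtain R a b where R: "R \<in> set reps" "length R = length T" and a: "a \<in> set units"
    and into: "\<forall>x\<in>set R. (a * x + b) mod int n \<in> set T"
    unfolding has_affine_rep_def ex_lazy_iff maps_into_iff by (auto split: if_splits)
  have "coprime a (int n)" using a units by blast
  \<comment> \<open>The computation tests only inclusion. A unit multiplier is injective on
    residues, so equal lengths upgrade inclusion to equality.\<close>
  have "card ((\<lambda>x. (a * x + b) mod int n) ` set R) = card (set T)"
    using reps R T inj_on_subset[OF affine_inj_on[OF \<open>coprime a (int n)\<close>]]
    by (simp add: card_image distinct_card)
  then have "(\<lambda>x. (a * x + b) mod int n) ` set R = set T"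
    using into by (intro card_subset_eq) auto
  then show ?thesis
    unfolding affine_equiv_def using R(1) \<open>coprime a (int n)\<close> by blast
qed

lemma closed_repsD:
  assumes n: "n > 0" and closed: "closed_reps (int n) reps units" and nil: "[] \<in> set reps"
    and units: "\<forall>a\<in>set units. coprime a (int n)"
    and reps: "\<forall>R\<in>set reps. distinct R \<and> set R \<subseteq> Zn n"
    and S: "S \<subseteq> Zn n"
  shows "\<exists>R\<in>set reps. affine_equiv n (set R) S"
proof -
  have "finite S" using S finite_subset by blast
  then show ?thesis
    using S
  proof (induction S rule: finite_induct)
    case empty
    have "affine_equiv n (set []) {}"
      unfolding affine_equiv_def by (rule exI[of _ 1]) simp
    then show ?case using nil by blast
  next
    case (insert x S)
    then obtain R where R: "R \<in> set reps" and "affine_equiv n (set R) S"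
      by blast
    then obtain a b where a: "coprime a (int n)" and S: "S = (\<lambda>x. (a * x + b) mod int n) ` set R"
      unfolding affine_equiv_def by blast
    from insert.prems have "x \<in> Zn n" by simp
    \<comment> \<open>The new point is pulled back along the affine map, so that it is added to the
      representative itself, where closure was checked.\<close>
    then obtain x' where x': "x' \<in> Zn n" "(a * x' + b) mod int n = x"
      using affine_surj[OF n a] by blast
    have "x' \<notin> set R"
      using insert.hyps(2) x'(2) unfolding S by blast
    moreover have "x' \<in> set [0..int n - 1]"
      using x'(1) by auto
    ultimately have "has_affine_rep (int n) reps units (x' # R)"
      using closed R unfolding closed_reps_def by (metis (full_types))
    then obtain R' where R': "R' \<in> set reps" "affine_equiv n (set R') (set (x' # R))"
      using has_affine_repD[of n reps units "x' # R"] units reps R \<open>x' \<notin> set R\<close> by auto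
    have "insert x S = (\<lambda>x. (a * x + b) mod int n) ` set (x' # R)"
      using x'(2) by (simp add: S)
    then have "affine_equiv n (set (x' # R)) (insert x S)"
      unfolding affine_equiv_def using a by blast
    then show ?case
      using R' affine_equiv_trans by blast
  qed
qed

lemma overlap_set:
  assumes "distinct R" shows "overlap n (set R) d = overlap_list (int n) R d"
proof -
  have "{s \<in> set R. (s + d) mod int n \<in> set R} = set (filter (\<lambda>s. (s + d) mod int n \<in> set R) R)"
    by auto
  then show ?thesis
    unfolding overlap_def overlap_list_def using assms by (simp only: distinct_card distinct_filter)
qed

lemma triangles_set:
  assumes "distinct D" shows "triangles n (set D) = triangles_list (int n) D"
proof -
  have "{(d, e) \<in> set D \<times> set D. (e - d) mod int n \<in> set D} =
    set (filter (\<lambda>(d, e). (e - d) mod int n \<in> set D) (List.product D D))"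
    by auto
  then show ?thesis
    unfolding triangles_def triangles_list_def
    using assms by (simp only: distinct_card distinct_filter distinct_product)
qed

lemma profile_eq:
  assumes "distinct R"
  shows "profile (int n) R = map (overlap_triangles n (set R)) [1..<n + 1]"
proof -
  have "overlap_triangles n (set R) c =
      triangles_list (int n) (filter (\<lambda>d. overlap_list (int n) R d = c) [0..int n - 1])" for c
  proof -
    have "{d \<in> Zn n. overlap n (set R) d = c} =
        set (filter (\<lambda>d. overlap_list (int n) R d = c) [0..int n - 1])"
      using assms by (auto simp: overlap_set)
    then show ?thesis
      unfolding overlap_triangles_def by (simp only: triangles_set distinct_filter distinct_upto)
  qed
  then show ?thesis
    by (simp add: profile_def)
qed

text \<open>Affine maps also induce isomorphisms, so S and T have the profiles of their
  representatives; equal profiles force the same representative.\<close>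

lemma haar_iso_imp_affine_equiv_if_profiles_distinct:
  assumes n: "n > 0" and closed: "closed_reps (int n) reps units" and nil: "[] \<in> set reps"
    and units: "\<forall>a\<in>set units. coprime a (int n)"
    and reps: "\<forall>R\<in>set reps. distinct R \<and> set R \<subseteq> Zn n"
    and dist: "distinct (map (profile (int n)) reps)"
    and S: "S \<subseteq> Zn n" and T: "T \<subseteq> Zn n" and iso: "haar_iso n S T"
  shows "affine_equiv n S T"
proof -
  obtain R where R: "R \<in> set reps" "affine_equiv n (set R) S"
    using closed_repsD[OF n closed nil units reps S] by blast
  obtain R' where R': "R' \<in> set reps" "affine_equiv n (set R') T"
    using closed_repsD[OF n closed nil units reps T] by blast
  have RR': "distinct R" "set R \<subseteq> Zn n" "distinct R'" "set R' \<subseteq> Zn n"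
    using reps R R' by auto
  have "overlap_triangles n (set R) c = overlap_triangles n (set R') c" if "c > 0" for c
    using haar_iso_imp_overlap_triangles_eq[OF n S T iso that]
      haar_iso_imp_overlap_triangles_eq[OF n RR'(2) S haar_iso_if_affine_equiv[OF n RR'(2) R(2)] that]
      haar_iso_imp_overlap_triangles_eq[OF n RR'(4) T haar_iso_if_affine_equiv[OF n RR'(4) R'(2)] that]
    by simp
  then have "profile (int n) R = profile (int n) R'"
    by (simp add: profile_eq RR' del: upt_Suc)
  then have "R = R'"
    using dist R(1) R'(1) by (auto simp: distinct_map dest: inj_onD)
  then show ?thesis
    using affine_equiv_trans[OF affine_equiv_sym[OF RR'(2) R(2)]] R'(2) by blast
qed

lemma haar_iso_4_imp_affine_equiv:
  assumes "S \<subseteq> Zn 4" "T \<subseteq> Zn 4" "haar_iso 4 S T"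
  shows "affine_equiv 4 S T"
proof (rule haar_iso_imp_affine_equiv_if_profiles_distinct[OF _ _ _ _ _ _ assms])
  show "closed_reps (int 4) reps4 [1, 3]" using closed_reps4 by simp
  show "distinct (map (profile (int 4)) reps4)" using distinct_profile4 by simp
  show "\<forall>a\<in>set [1, 3]. coprime a (int 4)" by simp code_simp
qed (auto simp: reps4_def)

lemma haar_iso_9_imp_affine_equiv:
  assumes "S \<subseteq> Zn 9" "T \<subseteq> Zn 9" "haar_iso 9 S T"
  shows "affine_equiv 9 S T"
proof (rule haar_iso_imp_affine_equiv_if_profiles_distinct[OF _ _ _ _ _ _ assms])
  show "closed_reps (int 9) reps9 [1, 2, 4, 5, 7, 8]" using closed_reps9 by simp
  show "distinct (map (profile (int 9)) reps9)" using distinct_profile9 by simp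
  show "\<forall>a\<in>set [1, 2, 4, 5, 7, 8]. coprime a (int 9)" by simp code_simp
qed (auto simp: reps9_def)

section \<open>Isomorphic graphs without an affine map\<close>

definition block_set :: "nat \<Rightarrow> nat \<Rightarrow> int set \<Rightarrow> int set" where
  "block_set q r A = {x \<in> Zn (q * r). x mod int q = 1 \<or> x mod int q = 0 \<and> x div int q \<in> A}"

text \<open>In the mixed radix notation with low digit t below q there is no carry, so reduction
  modulo q r only reduces the high digit s modulo r.\<close>

lemma mult_mod_block: "(int q * s + t) mod int (q * r) = int q * (s mod int r) + t"
  if "0 \<le> t" "t < int q" "r > 0"
proof -
  have "(int q * s + t) mod (int q * int r) =
      int q * ((int q * s + t) div int q mod int r) + (int q * s + t) mod int q"
    by (rule zmod_zmult2_eq) simp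
  moreover have "(int q * s + t) div int q = s" "(int q * s + t) mod int q = t"
    using that by auto
  ultimately show ?thesis by simp
qed

text \<open>The map keeps the low digit x mod q and multiplies the high digit x div q by m. Between
  equal low digits, differences lie in P and get multiplied by m. Between unequal ones a borrow may
  spoil linearity of the high digit, but there membership depends on the residue modulo q alone,
  because 1 + P is taken in full.\<close>

lemma haar_iso_block_set:
  assumes q: "q > 1" and r: "r > 0" and m: "coprime m (int r)" and A: "A \<subseteq> Zn r"
  shows "haar_iso (q * r) (block_set q r A) (block_set q r ((\<lambda>x. (m * x) mod int r) ` A))"
proof -
  let ?n = "int (q * r)"
  let ?B = "(\<lambda>x. (m * x) mod int r) ` A"
  have n: "q * r > 0" using q r by simp
  define \<sigma> where "\<sigma> x = (if x \<in> Zn (q * r)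
    then int q * ((m * (x div int q)) mod int r) + x mod int q else x)" for x
  have \<sigma>_mod: "\<sigma> x mod int q = x mod int q" and \<sigma>_div: "\<sigma> x div int q = (m * (x div int q)) mod int r"
    if "x \<in> Zn (q * r)" for x
  proof -
    have "\<sigma> x = int q * ((m * (x div int q)) mod int r) + x mod int q"
      unfolding \<sigma>_def using that by (rule if_P)
    moreover have "0 \<le> x mod int q" "x mod int q < int q" using q by auto
    ultimately show "\<sigma> x mod int q = x mod int q" "\<sigma> x div int q = (m * (x div int q)) mod int r"
      by auto
  qed
  have div_Zn: "x div int q \<in> Zn r" if "x \<in> Zn (q * r)" for x
  proof -
    have "x div int q * int q \<le> x"
      using q pos_mod_sign[of "int q" x] div_mult_mod_eq[of x "int q"] by linarith
    also have "x < int r * int q" using that by (simp add: mult.commute)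
    finally have "x div int q < int r" using q by simp
    then show ?thesis using that q by (simp add: pos_imp_zdiv_nonneg_iff)
  qed
  have "inj_on \<sigma> (Zn (q * r))"
  proof (rule inj_onI)
    fix x y assume xy: "x \<in> Zn (q * r)" "y \<in> Zn (q * r)" and eq: "\<sigma> x = \<sigma> y"
    have "(m * (x div int q)) mod int r = (m * (y div int q)) mod int r"
      using \<sigma>_div[OF xy(1)] \<sigma>_div[OF xy(2)] eq by simp
    then have "int r dvd m * (x div int q - y div int q)"
      by (simp add: mod_eq_dvd_iff right_diff_distrib)
    then have "int r dvd x div int q - y div int q"
      by (rule coprime_dvd_cancel[OF m])
    then have "x div int q = y div int q"
      by (simp only: Zn_eq_iff_dvd[OF div_Zn[OF xy(1)] div_Zn[OF xy(2)]])
    moreover have "x mod int q = y mod int q"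
      using \<sigma>_mod[OF xy(1)] \<sigma>_mod[OF xy(2)] eq by simp
    ultimately show "x = y"
      by (metis mult_div_mod_eq)
  qed
  moreover have "\<sigma> ` Zn (q * r) \<subseteq> Zn (q * r)"
  proof
    fix z assume "z \<in> \<sigma> ` Zn (q * r)"
    then obtain x where x: "x \<in> Zn (q * r)" and "z = \<sigma> x" by blast
    then have "z = int q * ((m * (x div int q)) mod int r) + x mod int q"
      unfolding \<sigma>_def by (metis (full_types))
    also have "\<dots> = (int q * (m * (x div int q)) + x mod int q) mod ?n"
      using q r by (intro mult_mod_block[symmetric]) auto
    finally show "z \<in> Zn (q * r)" using n by simp
  qed
  ultimately have "bij_betw \<sigma> (Zn (q * r)) (Zn (q * r))"
    by (simp add: bij_betw_def endo_inj_surj)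
  then have perm: "\<sigma> permutes Zn (q * r)"
    by (rule bij_imp_permutes) (simp only: \<sigma>_def if_False)
  have mem: "(y - x) mod ?n \<in> block_set q r X \<longleftrightarrow> (y - x) mod int q = 1 \<or>
      x mod int q = y mod int q \<and> (y div int q - x div int q) mod int r \<in> X" for x y X
  proof -
    have 1: "(y - x) mod ?n mod int q = (y - x) mod int q"
      by (simp add: mod_mod_cancel)
    have 2: "(y - x) mod ?n \<in> Zn (q * r)" using n by simp
    show ?thesis
    proof (cases "x mod int q = y mod int q")
      case True
      then have "int q dvd y - x" by (simp add: mod_eq_dvd_iff dvd_diff_commute)
      have "y - x = int q * (y div int q - x div int q) + 0"
        using True mult_div_mod_eq[of "int q" x] mult_div_mod_eq[of "int q" y]
        by (simp only: right_diff_distrib)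
      then have "(y - x) mod ?n = int q * ((y div int q - x div int q) mod int r) + 0"
        using mult_mod_block[of 0 q r "y div int q - x div int q"] q r by simp
      then have "(y - x) mod ?n div int q = (y div int q - x div int q) mod int r"
        using q by simp
      moreover have "(y - x) mod int q = 0" using \<open>int q dvd y - x\<close> by simp
      ultimately show ?thesis
        using 1 2 True by (simp add: block_set_def)
    next
      case False
      then have "(y - x) mod int q \<noteq> 0"
        by (metis dvd_eq_mod_eq_0 mod_eq_dvd_iff)
      then show ?thesis
        using 1 2 False by (simp add: block_set_def)
    qed
  qed
  have B: "(m * t) mod int r \<in> ?B \<longleftrightarrow> t mod int r \<in> A" for t
  proof
    assume "(m * t) mod int r \<in> ?B"
    then obtain a where a: "a \<in> A" "(m * t) mod int r = (m * a) mod int r" by blast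
    then have "int r dvd m * (t - a)"
      by (simp add: mod_eq_dvd_iff right_diff_distrib)
    then have "int r dvd t - a"
      by (rule coprime_dvd_cancel[OF m])
    then have "t mod int r = a mod int r"
      by (simp only: mod_eq_dvd_iff)
    also have "\<dots> = a" using a(1) A by auto
    finally show "t mod int r \<in> A" using a(1) by simp
  next
    assume "t mod int r \<in> A"
    then have "(m * (t mod int r)) mod int r \<in> ?B" by blast
    then show "(m * t) mod int r \<in> ?B" by (simp only: mod_mult_right_eq)
  qed
  have "design_iso (q * r) (block_set q r A) (block_set q r ?B) \<sigma>"
    unfolding design_iso_def
  proof (intro conjI perm exI[of _ \<sigma>] ballI)
    fix x y assume xy: "x \<in> Zn (q * r)" "y \<in> Zn (q * r)"
    have "(\<sigma> y - \<sigma> x) mod int q = (y - x) mod int q"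
      using \<sigma>_mod[OF xy(1)] \<sigma>_mod[OF xy(2)] by (metis mod_diff_eq)
    moreover have "(\<sigma> y div int q - \<sigma> x div int q) mod int r =
        (m * (y div int q - x div int q)) mod int r"
      by (simp only: \<sigma>_div[OF xy(1)] \<sigma>_div[OF xy(2)] mod_diff_eq right_diff_distrib)
    ultimately show "(y - x) mod ?n \<in> block_set q r A \<longleftrightarrow> (\<sigma> y - \<sigma> x) mod ?n \<in> block_set q r ?B"
      unfolding mem by (simp only: \<sigma>_mod[OF xy(1)] \<sigma>_mod[OF xy(2)] B)
  qed
  then show ?thesis
    by (rule haar_iso_if_design_iso)
qed

text \<open>Modulo q the map sends 0 and 1 into {0, 1}, because A is nonempty. It cannot send 1 to
  0, as 1 + P would then fill P and B would be everything. So it fixes 1, hence also 0 by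
  injectivity, which gives b = 0 and a = 1 modulo q.\<close>

lemma affine_equiv_block_setD:
  assumes q: "q > 1" and r: "r > 0" and A: "A \<subseteq> Zn r" "A \<noteq> {}" and B: "B \<subseteq> Zn r" "B \<noteq> Zn r"
    and aff: "affine_equiv (q * r) (block_set q r A) (block_set q r B)"
  obtains a c where "a mod int q = 1" "B = (\<lambda>s. (a * s + c) mod int r) ` A"
proof -
  let ?n = "int (q * r)"
  have n: "q * r > 0" using q r by simp
  from aff obtain a b where a: "coprime a ?n"
    and img: "block_set q r B = (\<lambda>x. (a * x + b) mod ?n) ` block_set q r A"
    unfolding affine_equiv_def by blast
  have aq: "coprime a (int q)" using a by simp
  have modq: "(a * x + b) mod ?n mod int q = (a * x + b) mod int q" for x
    by (simp add: mod_mod_cancel)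
  have res: "(a * x + b) mod int q \<in> {0, 1}" if "x \<in> block_set q r A" for x
  proof -
    have "(a * x + b) mod ?n \<in> block_set q r B" using that img by blast
    then show ?thesis using modq[of x] by (auto simp: block_set_def)
  qed
  have blk: "int q * s \<in> block_set q r X \<longleftrightarrow> s \<in> X" if "X \<subseteq> Zn r" for s X
  proof -
    have "int q * s \<in> Zn (q * r) \<longleftrightarrow> s \<in> Zn r"
      using q by (simp add: zero_le_mult_iff)
    then show ?thesis
      using q that by (auto simp: block_set_def)
  qed
  have one: "1 \<in> block_set q r A"
  proof -
    have "int q * 1 \<le> int q * int r"
      using r by (intro mult_left_mono) auto
    then have "1 < int q * int r" using q by linarith
    then show ?thesis using q by (simp add: block_set_def)
  qed
  have "(a + b) mod int q \<noteq> 0"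
  proof
    assume 0: "(a + b) mod int q = 0"
    have "s \<in> B" if s: "s \<in> Zn r" for s
    proof -
      have z: "int q * s \<in> Zn (q * r)"
        using s q by (simp add: zero_le_mult_iff)
      then obtain x where x: "x \<in> Zn (q * r)" "(a * x + b) mod ?n = int q * s"
        using affine_surj[OF n a] by blast
      have "(a * x + b) mod int q = 0"
        using modq[of x] x(2) by simp
      then have "int q dvd (a * x + b) - (a + b)"
        using 0 by (metis mod_eq_dvd_iff)
      then have "int q dvd a * (x - 1)" by (simp add: algebra_simps)
      then have "int q dvd x - 1" by (rule coprime_dvd_cancel[OF aq])
      then have "x mod int q = 1"
        using q by (metis mod_eq_dvd_iff mod_pos_pos_trivial of_nat_1 of_nat_less_iff zero_le_one)
      then have "x \<in> block_set q r A" using x(1) by (simp add: block_set_def)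
      then have "int q * s \<in> block_set q r B" using img x(2) by force
      then show "s \<in> B" using blk[OF B(1)] by blast
    qed
    then show False using B by blast
  qed
  then have ab: "(a + b) mod int q = 1"
    using res[OF one] by simp
  obtain s0 where s0: "s0 \<in> A" using A by blast
  have qs: "(a * (int q * s) + b) mod int q = b mod int q" for s
    by (metis mult.left_commute add.commute mod_mult_self2)
  \<comment> \<open>Otherwise 0 and 1 would have the same image modulo q, although a is a
    unit.\<close>
  have "b mod int q \<noteq> 1"
  proof
    assume "b mod int q = 1"
    then have "int q dvd (a + b) - b" using ab by (metis mod_eq_dvd_iff)
    then have "int q dvd a" by simp
    then show False
      using coprime_common_divisor[OF aq _ dvd_refl] q by simp
  qed
  then have b0: "int q dvd b"
    using res[of "int q * s0"] blk[OF A(1)] s0 qs by auto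
  then obtain c where c: "b = int q * c" by (rule dvdE)
  have a1: "a mod int q = 1"
    using ab b0 by (auto elim!: dvdE)
  have lin: "(a * (int q * s) + b) mod ?n = int q * ((a * s + c) mod int r)" for s
  proof -
    have "a * (int q * s) + b = int q * (a * s + c) + 0"
      by (simp add: c algebra_simps)
    then show ?thesis
      using mult_mod_block[of 0 q r "a * s + c"] q r by simp
  qed
  have "B = (\<lambda>s. (a * s + c) mod int r) ` A"
  proof (intro equalityI subsetI)
    fix t assume "t \<in> B"
    then have "int q * t \<in> block_set q r B" using blk[OF B(1)] by blast
    then obtain x where x: "x \<in> block_set q r A" "int q * t = (a * x + b) mod ?n"
      unfolding img by blast
    have "(a * x + b) mod int q = 0"
      using modq[of x] unfolding x(2)[symmetric] by simp
    then have "int q dvd a * x"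
      using b0 by (simp add: dvd_add_left_iff mod_eq_0_iff_dvd)
    then have "int q dvd x" by (rule coprime_dvd_cancel[OF aq])
    then obtain s where s: "x = int q * s" by (rule dvdE)
    then have "s \<in> A" using x(1) blk[OF A(1)] by blast
    moreover have "t = (a * s + c) mod int r"
      using x(2) q unfolding s lin by simp
    ultimately show "t \<in> (\<lambda>s. (a * s + c) mod int r) ` A" by blast
  next
    fix t assume "t \<in> (\<lambda>s. (a * s + c) mod int r) ` A"
    then obtain s where s: "s \<in> A" "t = (a * s + c) mod int r" by blast
    then have "(a * (int q * s) + b) mod ?n \<in> block_set q r B"
      using img blk[OF A(1)] by blast
    then show "t \<in> B" unfolding lin s(2) using blk[OF B(1)] by blast
  qed
  with a1 that show thesis by blast
qed

text \<open>As p divides q, a multiplier that is 1 modulo q is 1 modulo p, so the affine map acts on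
  the high digits as a translation.\<close>

lemma haar_iso_not_affine_equiv_prime:
  assumes q: "q > 1" and p: "5 \<le> p" and pq: "p dvd q" and odd: "odd p"
  shows "\<exists>S T. S \<subseteq> Zn (q * p) \<and> T \<subseteq> Zn (q * p) \<and> haar_iso (q * p) S T \<and> \<not> affine_equiv (q * p) S T"
proof -
  let ?A = "{0, 1 :: int}" and ?B = "{0, 2 :: int}"
  have "(\<lambda>x. (2 * x) mod int p) ` ?A = ?B" using p by auto
  then have iso: "haar_iso (q * p) (block_set q p ?A) (block_set q p ?B)"
    using haar_iso_block_set[OF q, of p 2 ?A] p odd by simp
  have "\<not> affine_equiv (q * p) (block_set q p ?A) (block_set q p ?B)"
  proof
    assume aff: "affine_equiv (q * p) (block_set q p ?A) (block_set q p ?B)"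
    have "1 \<in> Zn p" "1 \<notin> ?B" using p by simp_all
    then have "?B \<noteq> Zn p" by blast
    then obtain a c where a: "a mod int q = 1" and B: "?B = (\<lambda>s. (a * s + c) mod int p) ` ?A"
      using affine_equiv_block_setD[OF q _ _ _ _ _ aff] p by auto
    have "a mod int p = (a mod int q) mod int p"
      using pq by (simp add: mod_mod_cancel)
    then have "a mod int p = 1" using a p by simp
    then have "(a + c) mod int p = (1 + c mod int p) mod int p"
      by (metis mod_add_eq mod_mod_trivial)
    then have "?B = {c mod int p, (1 + c mod int p) mod int p}"
      using B by auto
    \<comment> \<open>A translate of {0, 1} equals {0, 2} only if 2 is 1 or -1 modulo p, that is, if
      p divides 1 or 3.\<close>
    then show False
      using p by (auto simp: doubleton_eq_iff dest: zdvd_imp_le)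
  qed
  moreover have "block_set q p X \<subseteq> Zn (q * p)" for X by (auto simp: block_set_def)
  ultimately show ?thesis using iso by blast
qed

text \<open>The set {0, 1, 3} is compared with its negative; -1 is not 1 modulo 3, and no admissible
  multiplier can replace it.\<close>

lemma haar_iso_not_affine_equiv_9:
  assumes q: "q > 1" and pq: "3 dvd q"
  shows "\<exists>S T. S \<subseteq> Zn (q * 9) \<and> T \<subseteq> Zn (q * 9) \<and> haar_iso (q * 9) S T \<and> \<not> affine_equiv (q * 9) S T"
proof -
  let ?A = "{0, 1, 3 :: int}" and ?B = "{0, 8, 6 :: int}"
  have "(\<lambda>x. (-1 * x) mod int 9) ` ?A = ?B" by auto
  then have iso: "haar_iso (q * 9) (block_set q 9 ?A) (block_set q 9 ?B)"
    using haar_iso_block_set[OF q, of 9 "-1" ?A] by simp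
  have "\<not> affine_equiv (q * 9) (block_set q 9 ?A) (block_set q 9 ?B)"
  proof
    assume aff: "affine_equiv (q * 9) (block_set q 9 ?A) (block_set q 9 ?B)"
    have "1 \<in> Zn 9" "1 \<notin> ?B" by simp_all
    then have "?B \<noteq> Zn 9" by blast
    then obtain a c where a: "a mod int q = 1" and B: "?B = (\<lambda>s. (a * s + c) mod int 9) ` ?A"
      using affine_equiv_block_setD[OF q _ _ _ _ _ aff] by auto
    have "a mod 3 = (a mod int q) mod 3"
      using pq int_dvd_int_iff[of 3 q] by (simp add: mod_mod_cancel)
    then have "a mod 3 = 1" using a by simp
    \<comment> \<open>These are the residues that are 1 modulo 3; with nine shifts, 27 affine maps
      remain to be checked.\<close>
    then have "a mod 9 \<in> set [1, 4, 7]" by simp presburger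
    moreover have "c mod 9 \<in> set [0..8]" by simp
    moreover have "\<forall>a\<in>set [1, 4, 7]. \<forall>c\<in>set [0..8].
      (\<lambda>s. (a * s + c) mod 9) ` {0, 1, 3} \<noteq> {0, 8, 6 :: int}" by code_simp
    ultimately have "(\<lambda>s. ((a mod 9) * s + c mod 9) mod 9) ` ?A \<noteq> ?B" by blast
    moreover have "((a mod 9) * s + c mod 9) mod 9 = (a * s + c) mod 9" for s
      using mod_affine[of s a 9 c] by (simp add: mod_simps mult.commute)
    ultimately have "(\<lambda>s. (a * s + c) mod 9) ` ?A \<noteq> ?B" by (simp only: not_False_eq_True)
    then show False
      unfolding B of_nat_numeral by (rule notE) (rule refl)
  qed
  moreover have "block_set q 9 X \<subseteq> Zn (q * 9)" for X by (auto simp: block_set_def)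
  ultimately show ?thesis using iso by blast
qed

section \<open>Counterexamples for multiples of 8\<close>

lemma dvd_parity_shift:
  fixes g \<delta> :: int
  shows "8 * g dvd 2 * \<delta> \<longleftrightarrow> 8 * g dvd 2 * \<delta> + 4 * g * \<delta>"
    and "8 * g dvd 2 * \<delta> - 2 \<longleftrightarrow> 8 * g dvd 2 * \<delta> + 4 * g * \<delta> - (2 + 4 * g)"
proof -
  have 4: "4 dvd x" if "8 * g dvd x" for x
  proof -
    have "(4::int) dvd 8 * g" by presburger
    then show ?thesis using that by (rule dvd_trans)
  qed
  have "(8 * g dvd 2 * \<delta> \<longleftrightarrow> 8 * g dvd 2 * \<delta> + 4 * g * \<delta>) \<and>
    (8 * g dvd 2 * \<delta> - 2 \<longleftrightarrow> 8 * g dvd 2 * \<delta> + 4 * g * \<delta> - (2 + 4 * g))"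
  \<comment> \<open>Modulo 8 g the term 4 g \<delta> is 0 for even \<delta> and 4 g for odd
    \<delta>. An even \<delta> concerns only the difference 0, an odd one only the difference 2,
    since the other is excluded modulo 4.\<close>
  proof (cases "even \<delta>")
    case True
    then obtain w where w: "\<delta> = 2 * w" by (rule evenE)
    have "2 * \<delta> + 4 * g * \<delta> = 2 * \<delta> + 8 * g * w"
      by (simp add: w)
    then have "8 * g dvd 2 * \<delta> \<longleftrightarrow> 8 * g dvd 2 * \<delta> + 4 * g * \<delta>"
      by (simp only: dvd_add_left_iff[OF dvd_triv_left])
    moreover have "\<not> 8 * g dvd 2 * \<delta> - 2"
    proof
      assume "8 * g dvd 2 * \<delta> - 2"
      from 4[OF this] show False unfolding w by presburger
    qed
    moreover have "\<not> 8 * g dvd 2 * \<delta> + 4 * g * \<delta> - (2 + 4 * g)"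
    proof
      assume "8 * g dvd 2 * \<delta> + 4 * g * \<delta> - (2 + 4 * g)"
      from 4[OF this] have "4 dvd 4 * (w + g * \<delta> - g) - 2" by (simp add: w algebra_simps)
      then show False by presburger
    qed
    ultimately show ?thesis by blast
  next
    case False
    then obtain w where w: "\<delta> = 2 * w + 1" by (rule oddE)
    have "2 * \<delta> + 4 * g * \<delta> - (2 + 4 * g) = (2 * \<delta> - 2) + 8 * g * w"
      by (simp add: w algebra_simps)
    then have "8 * g dvd 2 * \<delta> - 2 \<longleftrightarrow> 8 * g dvd 2 * \<delta> + 4 * g * \<delta> - (2 + 4 * g)"
      by (simp only: dvd_add_left_iff[OF dvd_triv_left])
    moreover have "\<not> 8 * g dvd 2 * \<delta>"
    proof
      assume "8 * g dvd 2 * \<delta>"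
      from 4[OF this] show False unfolding w by presburger
    qed
    moreover have "\<not> 8 * g dvd 2 * \<delta> + 4 * g * \<delta>"
    proof
      assume "8 * g dvd 2 * \<delta> + 4 * g * \<delta>"
      from 4[OF this] have "4 dvd 4 * (w + g * \<delta>) + 2" by (simp add: w algebra_simps)
      then show False by presburger
    qed
    ultimately show ?thesis by blast
  qed
  then show "8 * g dvd 2 * \<delta> \<longleftrightarrow> 8 * g dvd 2 * \<delta> + 4 * g * \<delta>"
    and "8 * g dvd 2 * \<delta> - 2 \<longleftrightarrow> 8 * g dvd 2 * \<delta> + 4 * g * \<delta> - (2 + 4 * g)"
    by blast+
qed

text \<open>Here n = 8 g and P = {0, 4 g}; the values of interest are e = 2 and e = 2 + 4 g. Both
  the isomorphism and the absence of an affine map hold for every g > 0, not only for powers of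
  2.\<close>

definition half_block_set :: "nat \<Rightarrow> int \<Rightarrow> int set" where
  "half_block_set g e = {x \<in> Zn (8 * g). x mod (4 * int g) = 1 \<or> x = 0 \<or> x = e}"

lemma mod_in_half_block_set_iff:
  assumes g: "g > 0" and e: "e \<in> Zn (8 * g)"
  shows "z mod int (8 * g) \<in> half_block_set g e \<longleftrightarrow>
    z mod (4 * int g) = 1 \<or> 8 * int g dvd z \<or> 8 * int g dvd z - e"
proof -
  have "z mod int (8 * g) mod (4 * int g) = z mod (4 * int g)"
    by (rule mod_mod_cancel) simp
  moreover have "z mod int (8 * g) \<in> Zn (8 * g)"
    using g by simp
  moreover have "z mod int (8 * g) = e \<longleftrightarrow> 8 * int g dvd z - e"
  proof -
    have "e mod int (8 * g) = e" using e by simp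
    then show ?thesis by (metis mod_eq_dvd_iff of_nat_mult of_nat_numeral)
  qed
  moreover have "z mod int (8 * g) = 0 \<longleftrightarrow> 8 * int g dvd z"
    by (simp add: dvd_eq_mod_eq_0)
  ultimately show ?thesis
    unfolding half_block_set_def mem_Collect_eq by (simp only: simp_thms)
qed

text \<open>The map exchanges the two elements of a coset of P exactly when x is 2 or 3 modulo 4.
  Thus a difference 0 is kept, a difference 2 becomes 2 + 4 g, and for odd differences only the
  coset of P matters.\<close>

lemma haar_iso_half_block_set:
  assumes g: "g > 0"
  shows "haar_iso (8 * g) (half_block_set g 2) (half_block_set g (2 + 4 * int g))"
proof -
  let ?n = "int (8 * g)"
  have n8: "?n = 8 * int g" by simp
  define \<sigma> where "\<sigma> x = (if x \<in> Zn (8 * g) then (x + 4 * int g * (x div 2)) mod ?n else x)" for x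
  have \<sigma>: "\<sigma> x = (x + 4 * int g * (x div 2)) mod ?n" if "x \<in> Zn (8 * g)" for x
    unfolding \<sigma>_def using that by (rule if_P)
  have into: "\<sigma> x \<in> Zn (8 * g)" if "x \<in> Zn (8 * g)" for x
    unfolding \<sigma>[OF that] using g by simp
  \<comment> \<open>Adding 4 g to x changes \<open>x div 2\<close> by 2 g, which is even, so the
    second application adds the same multiple of 4 g modulo 8 g.\<close>
  have invol: "\<sigma> (\<sigma> x) = x" if x: "x \<in> Zn (8 * g)" for x
  proof -
    define t where "t = (x + 4 * int g * (x div 2)) div ?n"
    have \<sigma>x: "\<sigma> x = x + 4 * (int g * (x div 2)) - 8 * (int g * t)"
      unfolding \<sigma>[OF x] t_def minus_div_mult_eq_mod[symmetric] n8 by (simp add: algebra_simps)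
    then have "\<sigma> x div 2 = x div 2 + 2 * (int g * (x div 2)) - 4 * (int g * t)"
      by presburger
    then have "\<sigma> x + 4 * int g * (\<sigma> x div 2) =
        x + ?n * ((x div 2) + int g * (x div 2) - t - 2 * (int g * t))"
      unfolding n8 by (simp only: \<sigma>x) (simp add: algebra_simps)
    then have "\<sigma> (\<sigma> x) = (x + ?n * ((x div 2) + int g * (x div 2) - t - 2 * (int g * t))) mod ?n"
      by (simp only: \<sigma>[OF into[OF x]])
    also have "\<dots> = x mod ?n" by (rule mod_mult_self2)
    finally show ?thesis using x by simp
  qed
  have "bij_betw \<sigma> (Zn (8 * g)) (Zn (8 * g))"
    by (rule bij_betw_byWitness[where f' = \<sigma>]) (use into invol in blast)+
  then have perm: "\<sigma> permutes Zn (8 * g)"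
    by (rule bij_imp_permutes) (simp only: \<sigma>_def if_False)
  have e: "2 \<in> Zn (8 * g)" "2 + 4 * int g \<in> Zn (8 * g)"
    using g by simp_all
  have "design_iso (8 * g) (half_block_set g 2) (half_block_set g (2 + 4 * int g)) \<sigma>"
    unfolding design_iso_def
  proof (intro conjI perm exI[of _ \<sigma>] ballI)
    fix x y assume xy: "x \<in> Zn (8 * g)" "y \<in> Zn (8 * g)"
    define D E where "D = y - x" and "E = D + 4 * int g * (y div 2 - x div 2)"
    have "(\<sigma> y - \<sigma> x) mod ?n = E mod ?n"
      unfolding \<sigma>[OF xy(1)] \<sigma>[OF xy(2)] mod_diff_eq by (simp add: E_def D_def algebra_simps)
    moreover have "E mod (4 * int g) = D mod (4 * int g)"
      unfolding E_def by (rule mod_mult_self2)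
    moreover have "(8 * int g dvd D \<longleftrightarrow> 8 * int g dvd E) \<and>
        (8 * int g dvd D - 2 \<longleftrightarrow> 8 * int g dvd E - (2 + 4 * int g))"
    \<comment> \<open>Odd differences can be none of 0, 2 and 2 + 4 g modulo 8 g, so all four
      divisibilities fail.\<close>
    proof (cases "even D")
      case True
      define \<delta> where "\<delta> = y div 2 - x div 2"
      have "D = 2 * \<delta>"
        using True unfolding D_def \<delta>_def by presburger
      then show ?thesis
        unfolding E_def \<delta>_def[symmetric] using dvd_parity_shift[of "int g" \<delta>] by simp
    next
      case False
      have "even z" if "8 * int g dvd z" for z
      proof -
        have "2 dvd 8 * int g" by simp
        then show ?thesis using that by (rule dvd_trans)
      qed
      moreover have "odd E" using False by (simp add: E_def)
      ultimately show ?thesis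
        using False by (metis dvd_add_right_iff even_add even_diff even_mult_iff even_numeral)
    qed
    ultimately show "(y - x) mod ?n \<in> half_block_set g 2 \<longleftrightarrow>
        (\<sigma> y - \<sigma> x) mod ?n \<in> half_block_set g (2 + 4 * int g)"
      unfolding D_def[symmetric] by (simp only: mod_in_half_block_set_iff[OF g e(1)] mod_in_half_block_set_iff[OF g e(2)])
  qed
  then show ?thesis
    by (rule haar_iso_if_design_iso)
qed

text \<open>The images b, a + b and 2 a + b of 0, 1 and 2 form an arithmetic progression in T with
  odd difference a; comparing them forces 2 g to divide g.\<close>

lemma not_affine_equiv_half_block_set:
  assumes g: "g > 0"
  shows "\<not> affine_equiv (8 * g) (half_block_set g 2) (half_block_set g (2 + 4 * int g))"
proof
  let ?n = "int (8 * g)" and ?T = "half_block_set g (2 + 4 * int g)"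
  assume "affine_equiv (8 * g) (half_block_set g 2) ?T"
  then obtain a b where a: "coprime a ?n" and img: "?T = (\<lambda>x. (a * x + b) mod ?n) ` half_block_set g 2"
    unfolding affine_equiv_def by blast
  have "odd a"
    using coprime_common_divisor[OF a, of 2] by auto
  have e: "2 + 4 * int g \<in> Zn (8 * g)"
    using g by simp
  have "(a * x + b) mod ?n \<in> ?T" if "x \<in> half_block_set g 2" for x
    unfolding img using that by blast
  then have mem: "(a * x + b) mod (4 * int g) = 1 \<or> 8 * int g dvd a * x + b \<or>
      8 * int g dvd a * x + b - (2 + 4 * int g)" if "x \<in> half_block_set g 2" for x
    using that unfolding mod_in_half_block_set_iff[OF g e] by blast
  \<comment> \<open>Keeping the multiple of g as a single unknown u makes the case analysis linear;
    that g divides u is needed only at the very end.\<close>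
  have red: "\<exists>u. int g dvd u \<and> (z = 1 + 4 * u \<or> z = 8 * u \<or> z = 2 + 4 * int g + 8 * u)"
    if z: "z mod (4 * int g) = 1 \<or> 8 * int g dvd z \<or> 8 * int g dvd z - (2 + 4 * int g)" for z
    using z
  proof (elim disjE)
    assume "z mod (4 * int g) = 1"
    then have "z = 1 + 4 * (int g * (z div (4 * int g)))"
      using mult_div_mod_eq[of "4 * int g" z] by (simp add: mult.assoc)
    then show ?thesis by (metis dvd_triv_left)
  next
    assume "8 * int g dvd z"
    then obtain j where "z = 8 * int g * j" by (rule dvdE)
    then have "z = 8 * (int g * j)" by simp
    then show ?thesis by (metis dvd_triv_left)
  next
    assume "8 * int g dvd z - (2 + 4 * int g)"
    then obtain j where "z - (2 + 4 * int g) = 8 * int g * j" by (rule dvdE)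
    then have "z = 2 + 4 * int g + 8 * (int g * j)" by simp
    then show ?thesis by (metis dvd_triv_left)
  qed
  have "0 \<in> half_block_set g 2" "1 \<in> half_block_set g 2" "2 \<in> half_block_set g 2"
    using g by (simp_all add: half_block_set_def)
  note r = this[THEN mem, THEN red, unfolded mult_zero_right mult_1_right add_0]
  obtain i where i: "int g dvd i" "a + b = 1 + 4 * i \<or> a + b = 8 * i \<or> a + b = 2 + 4 * int g + 8 * i"
    using r(2) by blast
  obtain j where j: "int g dvd j" "b = 1 + 4 * j \<or> b = 8 * j \<or> b = 2 + 4 * int g + 8 * j"
    using r(1) by blast
  obtain l where l: "int g dvd l" "a * 2 + b = 1 + 4 * l \<or> a * 2 + b = 8 * l \<or> a * 2 + b = 2 + 4 * int g + 8 * l"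
    using r(3) by blast
  \<comment> \<open>If b were odd, b and 2 a + b would both be 1 modulo 4 and a even. So a + b is
    the odd element, while b and 2 a + b differ by 2 a, which is not divisible by 8, and are
    therefore 0 and 2 + 4 g in some order.\<close>
  have "int g = 2 * (i - j - l)"
  proof -
    have "a \<noteq> 2 * u" for u
      using \<open>odd a\<close> by auto
    note a_ne = this[of "l - j"] this[of "2 * (l - j)"]
    have odd_case: "z = 1 + 4 * u"
      if "odd z" "z = 1 + 4 * u \<or> z = 8 * u \<or> z = 2 + 4 * int g + 8 * u" for z u
      using that by auto
    have "even b"
    proof (rule ccontr)
      assume "odd b"
      then have "b = 1 + 4 * j" "a * 2 + b = 1 + 4 * l"
        by (intro odd_case j(2) l(2); simp)+
      then have "a = 2 * (l - j)" by simp
      then show False using a_ne by blast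
    qed
    have ab: "a + b = 1 + 4 * i"
      using \<open>even b\<close> \<open>odd a\<close> by (intro odd_case i(2)) simp
    have "z \<noteq> 1 + 4 * u" if "even z" for z u :: int
      using that by auto
    from this[of "b" j] this[of "a * 2 + b" l]
    have "b \<noteq> 1 + 4 * j" "a * 2 + b \<noteq> 1 + 4 * l"
      using \<open>even b\<close> by simp_all
    then have "b = 8 * j \<or> b = 2 + 4 * int g + 8 * j"
      "a * 2 + b = 8 * l \<or> a * 2 + b = 2 + 4 * int g + 8 * l"
      using j(2) l(2) by blast+
    then have "int g = 2 * (i - j - l) \<or> a = 2 * (2 * (l - j))"
      using ab by (elim disjE) simp_all
    then show ?thesis using a_ne by blast
  qed
  \<comment> \<open>Since g divides i, j and l, g would be an even multiple of itself.\<close>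
  moreover obtain w where "i - j - l = int g * w"
    using i(1) j(1) l(1) by (meson dvd_diff dvdE)
  ultimately have "int g * (2 * w - 1) = 0"
    by (simp add: algebra_simps)
  moreover have "2 * w - 1 \<noteq> 0" by presburger
  ultimately show False using g by simp
qed

section \<open>Cyclic groups of prime power order\<close>

lemma (in group) cyclic_group_iso_integer_mod_group:
  assumes fin: "finite (carrier G)" and cyc: "cyclic_group G"
  shows "integer_mod_group (order G) \<cong> G"
proof -
  define n where "n = order G"
  have n: "n > 0" using fin by (simp add: n_def order_gt_0_iff_finite)
  obtain x where x: "x \<in> carrier G" and gen: "carrier G = range (\<lambda>i::int. x [^] i)"
    using cyc unfolding cyclic_group by blast
  have car: "carrier (integer_mod_group n) = Zn n"
    using n by (simp add: carrier_integer_mod_group)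
  have mod: "x [^] (i mod int n) = x [^] i" for i :: int
  proof -
    have "int (ord x) dvd int n"
      using ord_dvd_group_order[OF x] by (simp add: n_def)
    moreover have "int n dvd i - i mod int n"
      by (rule dvd_minus_mod)
    ultimately show ?thesis
      unfolding int_pow_eq[OF x] by (rule dvd_trans)
  qed
  have img: "(\<lambda>i::int. x [^] i) ` Zn n = carrier G"
  proof
    show "(\<lambda>i::int. x [^] i) ` Zn n \<subseteq> carrier G" using gen by blast
    show "carrier G \<subseteq> (\<lambda>i::int. x [^] i) ` Zn n"
    proof
      fix y assume "y \<in> carrier G"
      then obtain i :: int where "y = x [^] i" unfolding gen by blast
      then have "y = x [^] (i mod int n)" by (simp only: mod)
      moreover have "i mod int n \<in> Zn n" using n by simp
      ultimately show "y \<in> (\<lambda>i::int. x [^] i) ` Zn n" by (rule image_eqI)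
    qed
  qed
  have "inj_on (\<lambda>i::int. x [^] i) (Zn n)"
    by (rule eq_card_imp_inj_on) (simp, unfold img, simp add: n_def order_def)
  with img have "bij_betw (\<lambda>i::int. x [^] i) (carrier (integer_mod_group n)) (carrier G)"
    unfolding car bij_betw_def by blast
  moreover have "(\<lambda>i::int. x [^] i) \<in> hom (integer_mod_group n) G"
    by (rule homI) (use x in \<open>simp_all add: mod int_pow_mult\<close>)
  ultimately have "(\<lambda>i::int. x [^] i) \<in> iso (integer_mod_group n) G"
    by (simp add: iso_def)
  then show ?thesis
    unfolding n_def is_iso_def by blast
qed

lemma BCI_integer_mod_group_prime_power_iff:
  assumes p: "Factorial_Ring.prime p" and k: "k > 0"
  shows "BCI_group (integer_mod_group (p ^ k)) \<longleftrightarrow>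
    p ^ k \<in> {2, 4, 3, 9} \<or> Factorial_Ring.prime (p ^ k) \<and> 5 \<le> p ^ k"
proof
  have pos: "p ^ k > 0" using prime_gt_0_nat[OF p] by simp
  assume "p ^ k \<in> {2, 4, 3, 9} \<or> Factorial_Ring.prime (p ^ k) \<and> 5 \<le> p ^ k"
  moreover have "Factorial_Ring.prime (2::nat)" "Factorial_Ring.prime (3::nat)" by simp_all
  ultimately consider "Factorial_Ring.prime (p ^ k)" | "p ^ k = 4" | "p ^ k = 9"
    by (metis empty_iff insert_iff)
  then have "affine_equiv (p ^ k) S T" if "S \<subseteq> Zn (p ^ k)" "T \<subseteq> Zn (p ^ k)" "haar_iso (p ^ k) S T" for S T
  proof cases
    case 1
    show ?thesis by (rule haar_iso_prime_imp_affine_equiv[OF 1 that])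
  next
    case 2
    show ?thesis using that unfolding 2 by (rule haar_iso_4_imp_affine_equiv)
  next
    case 3
    show ?thesis using that unfolding 3 by (rule haar_iso_9_imp_affine_equiv)
  qed
  then show "BCI_group (integer_mod_group (p ^ k))"
    unfolding BCI_integer_mod_group_iff[OF pos] by blast
next
  have pos: "p ^ k > 0" using prime_gt_0_nat[OF p] by simp
  assume "BCI_group (integer_mod_group (p ^ k))"
  then have BCI: "affine_equiv (p ^ k) S T"
    if "S \<subseteq> Zn (p ^ k)" "T \<subseteq> Zn (p ^ k)" "haar_iso (p ^ k) S T" for S T
    using that unfolding BCI_integer_mod_group_iff[OF pos] by blast
  have p2: "p \<ge> 2" by (rule prime_ge_2_nat[OF p])
  have "p \<noteq> 4" using p by (auto simp: prime_nat_iff dest: spec[of _ 2])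
  then consider "p = 2" | "p = 3" | "p \<ge> 5" using p2 by linarith
  then show "p ^ k \<in> {2, 4, 3, 9} \<or> Factorial_Ring.prime (p ^ k) \<and> 5 \<le> p ^ k"
  proof cases
    case 1
    have "k < 3"
    proof (rule ccontr)
      assume "\<not> k < 3"
      then have pk: "p ^ k = 8 * 2 ^ (k - 3)"
        using 1 power_add[of "2 :: nat" 3 "k - 3"] by simp
      have g: "(2::nat) ^ (k - 3) > 0" by simp
      have "half_block_set (2 ^ (k - 3)) e \<subseteq> Zn (8 * 2 ^ (k - 3))" for e
        unfolding half_block_set_def by blast
      then show False
        using BCI[unfolded pk, OF _ _ haar_iso_half_block_set[OF g]] not_affine_equiv_half_block_set[OF g]
        by blast
    qed
    then have "k = 1 \<or> k = 2" using k by linarith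
    then show ?thesis using 1 by auto
  next
    case 2
    have "k < 3"
    proof (rule ccontr)
      assume "\<not> k < 3"
      \<comment> \<open>The subgroup has order 9 and index 3^(k - 2); k >= 3 is what makes 3 divide
        the index.\<close>
      then have pk: "p ^ k = 3 ^ (k - 2) * 9"
        using 2 power_add[of p "k - 2" 2] le_add_diff_inverse2[of 2 k] by (simp del: add_2_eq_Suc')
      have "(3::nat) ^ (k - 2) > 1" "3 dvd (3::nat) ^ (k - 2)"
        using one_less_power[of "3 :: nat" "k - 2"] dvd_power[of "k - 2" "3 :: nat"] \<open>\<not> k < 3\<close>
        by linarith+
      from haar_iso_not_affine_equiv_9[OF this] show False
        using BCI unfolding pk by blast
    qed
    then have "k = 1 \<or> k = 2" using k by linarith
    then show ?thesis using 2 by auto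
  next
    case 3
    have "k < 2"
    proof (rule ccontr)
      assume "\<not> k < 2"
      \<comment> \<open>The subgroup has order p, and its index p^(k - 1) is divisible by p as k >=
        2.\<close>
      then have pk: "p ^ k = p ^ (k - 1) * p"
        using power_add[of p "k - 1" 1] by simp
      have "p ^ (k - 1) > 1" "p dvd p ^ (k - 1)"
        using one_less_power[of p "k - 1"] dvd_power[of "k - 1" p] \<open>\<not> k < 2\<close> p2
        by linarith+
      moreover have "odd p"
        using prime_odd_nat[OF p] 3 by linarith
      ultimately show False
        using haar_iso_not_affine_equiv_prime[of "p ^ (k - 1)" p] 3 BCI unfolding pk by blast
    qed
    then have "k = 1" using k by linarith
    then show ?thesis using 3 p by simp
  qed
qed

theorem theorem4:
  fixes G :: "('a, 'b) monoid_scheme" and p k :: nat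
  assumes "group G" and "finite (carrier G)" and "cyclic_group G"
    and "Factorial_Ring.prime p" and "order G = p ^ k"
    and "\<not> trivial_group G"
  shows "BCI_group G \<longleftrightarrow>
    G \<cong> integer_mod_group 2 \<or> G \<cong> integer_mod_group 4 \<or>
    G \<cong> integer_mod_group 3 \<or> G \<cong> integer_mod_group 9 \<or>
    (\<exists>q. Factorial_Ring.prime q \<and> 5 \<le> q \<and> G \<cong> integer_mod_group q)"
proof -
  interpret group G by fact
  let ?n = "p ^ k"
  have n: "?n > 0" using prime_gt_0_nat[OF assms(4)] by simp
  have iso: "integer_mod_group ?n \<cong> G"
    using cyclic_group_iso_integer_mod_group[OF assms(2,3)] unfolding assms(5) .
  then have iso': "G \<cong> integer_mod_group ?n"
    by (rule group.iso_sym[OF group_integer_mod_group])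
  have car: "carrier (integer_mod_group m) = Zn m" if "m > 0" for m
    using that by (simp add: carrier_integer_mod_group)
  \<comment> \<open>The exponent 0 is ruled out by nontriviality.\<close>
  have "k \<noteq> 0"
  proof
    assume "k = 0"
    then have "card (carrier G) = 1" using assms(5) by (simp add: order_def)
    then have "carrier G = {\<one>\<^bsub>G\<^esub>}"
      by (metis card_1_singletonE one_closed singletonD)
    then show False
      using assms(1,6) by (simp add: trivial_group_def)
  qed
  \<comment> \<open>A group isomorphic to Z_m has order m, so each alternative of the classification
    becomes an equation for p^k.\<close>
  have eq: "G \<cong> integer_mod_group m \<longleftrightarrow> m = ?n" if "m > 0" for m
  proof
    assume "G \<cong> integer_mod_group m"
    then have "card (carrier G) = card (carrier (integer_mod_group m))"
      by (rule iso_same_card)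
    then show "m = ?n"
      using assms(5) by (simp add: car[OF that] order_def)
  qed (use iso' in simp)
  have "finite (carrier (integer_mod_group ?n))"
    by (simp add: car[OF n])
  then have "BCI_group G \<longleftrightarrow> BCI_group (integer_mod_group ?n)"
    using BCI_group_iso_imp[OF assms(1,2) group_integer_mod_group iso']
      BCI_group_iso_imp[OF group_integer_mod_group _ assms(1) iso] by blast
  also have "\<dots> \<longleftrightarrow> ?n \<in> {2, 4, 3, 9} \<or> Factorial_Ring.prime ?n \<and> 5 \<le> ?n"
    using \<open>k \<noteq> 0\<close> by (intro BCI_integer_mod_group_prime_power_iff[OF assms(4)]) simp
  also have "\<dots> \<longleftrightarrow> G \<cong> integer_mod_group 2 \<or> G \<cong> integer_mod_group 4 \<or>
    G \<cong> integer_mod_group 3 \<or> G \<cong> integer_mod_group 9 \<or>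
    (\<exists>q. Factorial_Ring.prime q \<and> 5 \<le> q \<and> G \<cong> integer_mod_group q)"
  proof -
    have "(\<exists>q. Factorial_Ring.prime q \<and> 5 \<le> q \<and> G \<cong> integer_mod_group q) \<longleftrightarrow>
        Factorial_Ring.prime ?n \<and> 5 \<le> ?n"
      using eq[OF prime_gt_0_nat] by blast
    moreover have "G \<cong> integer_mod_group 2 \<longleftrightarrow> ?n = 2" "G \<cong> integer_mod_group 4 \<longleftrightarrow> ?n = 4"
      "G \<cong> integer_mod_group 3 \<longleftrightarrow> ?n = 3" "G \<cong> integer_mod_group 9 \<longleftrightarrow> ?n = 9"
      using eq[of 2] eq[of 4] eq[of 3] eq[of 9] by auto
    ultimately show ?thesis by blast
  qed
  finally show ?thesis .
qed

end
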